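(* Let $\pi^C$, given by $(\bm v,K)$, be an optimal solution of the output-feedback estimate-history-affine problem $$\min_{\bm v,K}\ J\quad\text{s.t.}\quad g_x(\mathbb{E}[x_k],\mathrm{Cov}(x_k))\le 0\ (k=1,\dots,N),\quad g_u(\mathbb{E}[u_k],\mathrm{Cov}(u_k))\le 0\ (k=0,\dots,N-1),$$ where the minimization is over all $\bm v=(v_0,\dots,v_{N-1})$ and all gains $\{K_{k,i}\}_{0\le i\le k\le N-1}$, with no further restriction, the controls are $u_k=\pi_k^C(\hat x_0,\dots,\hat x_k)=v_k+\sum_{i=0}^kK_{k,i}(\hat x_i-\mathbb{E}[\hat x_i])$, and $g_x,g_u$ are covariance-monotonic. With all moments taken under $\pi^C$, set $$H_k=P_{u\hat x,k}P_{\hat x,k}^\dagger,\qquad \pi^M_k(\hat x_k)=v_k+H_k(\hat x_k-\mathbb{E}[\hat x_k]),\qquad k=0,\dots,N-1.$$ Then this current-estimate-affine policy satisfies $$\pi_k^C(\hat x_0,\dots,\hat x_k)=\pi_k^M(\hat x_k)\quad\text{almost surely},\qquad k=0,\dots,N-1,$$ where $\hat x_0,\dots,\hat x_k$ is the estimate process generated under $\pi^C$.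
   Context: System: for $k=0,\dots,N-1$, $x_{k+1}=A_kx_k+B_ku_k+G_kw_k$ with $x_k\in\mathbb{R}^n$, $u_k\in\mathbb{R}^m$, $w_k\in\mathbb{R}^l$, where $\{w_k\}_{k=0}^{N-1}$ is zero-mean white Gaussian noise with unit covariance, $x_0\sim\mathcal N(\mu_0,P_0)$ with $P_0\succeq0$, and $x_0$ is independent of $\{w_k\}_{k=0}^{N-1}$. Observations: $y_k=C_kx_k+D_k\eta_k$, where $\eta_k\sim\mathcal N(0,I)$ is i.i.d. and independent of $x_0$ and $\{w_k\}_{k=0}^{N-1}$. The initial state estimate $\hat x_0^-$ is Gaussian and independent of the initial estimation error $\widetilde x_0^-=x_0-\hat x_0^-$. Let $\mathcal F_{-1}=\sigma(\hat x_0^-)$, $\mathcal F_k=\sigma(\hat x_0^-,y_0,\dots,y_k)$ and $\hat x_k=\mathbb{E}[x_k\mid\mathcal F_k]$ (the Kalman estimate). Here $K_{k,i}\in\mathbb{R}^{m\times n}$ and $v_k\in\mathbb{R}^m$. Under a given policy, $P_{\hat x,k}=\mathrm{Cov}(\hat x_k)$ and $P_{u\hat x,k}=\mathrm{Cov}(u_k,\hat x_k)=\mathbb{E}[(u_k-\mathbb{E}[u_k])(\hat x_k-\mathbb{E}[\hat x_k])^\top]$. Cost: $J=\sum_{k=0}^N\mathbb{E}[x_k^\top Q_kx_k]+\sum_{k=0}^{N-1}\mathbb{E}[u_k^\top R_ku_k]$ with $Q_k\succeq0$, $R_k\succ0$. Covariance-monotonic: a constraint $g(\mu,P)\le0$ with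 $\mu\in\mathbb{R}^d$ and $P\in\mathbb{S}_+^d$ (symmetric positive semidefinite $d\times d$ matrices) is covariance-monotonic if $P_1\preceq P_2$ implies $g(\mu,P_1)\le g(\mu,P_2)$. Here $g_x$ is defined on $\mathbb{R}^n\times\mathbb{S}_+^n$ and $g_u$ on $\mathbb{R}^m\times\mathbb{S}_+^m$. $X^\dagger$ denotes the Moore–Penrose pseudoinverse.
   Formalization: The initial estimate x̂_0^- is also assumed independent of the noises: (x_0, x̂_0^-), {w_k} and {η_k} are mutually independent. Without this x̂_0^- could reveal future noise, e.g. x̂_0^-=(x_0+w_1)/2, and the claim fails. *)

theory Defs
  imports "HOL-Probability.Probability"
begin

section \<open>Matrices and second moments\<close>

definition psd :: "real^'d^'d \<Rightarrow> bool" where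
  "psd P \<longleftrightarrow> transpose P = P \<and> (\<forall>x. 0 \<le> x \<bullet> (P *v x))"

definition posdef :: "real^'d^'d \<Rightarrow> bool" where
  "posdef P \<longleftrightarrow> transpose P = P \<and> (\<forall>x. x \<noteq> 0 \<longrightarrow> 0 < x \<bullet> (P *v x))"

definition loewner_le :: "real^'d^'d \<Rightarrow> real^'d^'d \<Rightarrow> bool" (infix \<open>\<preceq>\<^sub>L\<close> 50) where
  "P \<preceq>\<^sub>L P' \<longleftrightarrow> psd (P' - P)"

definition is_pinv :: "real^'n^'m \<Rightarrow> real^'m^'n \<Rightarrow> bool" where
  "is_pinv X Y \<longleftrightarrow> X ** Y ** X = X \<and> Y ** X ** Y = Y \<and>
     transpose (X ** Y) = X ** Y \<and> transpose (Y ** X) = Y ** X"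

text \<open>The Moore--Penrose pseudoinverse, as the unique solution of the four Penrose equations.\<close>

definition pinv :: "real^'n^'m \<Rightarrow> real^'m^'n" where
  "pinv X = (THE Y. is_pinv X Y)"

definition cov :: "'a measure \<Rightarrow> ('a \<Rightarrow> real^'m) \<Rightarrow> ('a \<Rightarrow> real^'n) \<Rightarrow> real^'n^'m" where
  "cov M X Y = (\<chi> i j. integral\<^sup>L M (\<lambda>\<omega>. (X \<omega> - integral\<^sup>L M X) $ i * (Y \<omega> - integral\<^sup>L M Y) $ j))"

text \<open>The law \<open>N(\<mu>, P)\<close> with possibly singular \<open>P\<close>: every linear functional is univariate normal,
  where a normal variable of variance zero is almost surely constant.\<close>

definition gaussian :: "'a measure \<Rightarrow> ('a \<Rightarrow> real^'d) \<Rightarrow> real^'d \<Rightarrow> real^'d^'d \<Rightarrow> bool" where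
  "gaussian M X \<mu> P \<longleftrightarrow> X \<in> borel_measurable M \<and>
     (\<forall>a. if a \<bullet> (P *v a) = 0 then AE \<omega> in M. a \<bullet> X \<omega> = a \<bullet> \<mu>
          else distributed M lborel (\<lambda>\<omega>. a \<bullet> X \<omega>) (normal_density (a \<bullet> \<mu>) (sqrt (a \<bullet> (P *v a)))))"

text \<open>Only the values of \<open>g\<close> at positive semidefinite second arguments are constrained, since the
  second argument ranges over covariance matrices.\<close>

definition cov_monotonic :: "(real^'d \<Rightarrow> real^'d^'d \<Rightarrow> real) \<Rightarrow> bool" where
  "cov_monotonic g \<longleftrightarrow>
     (\<forall>\<mu> P1 P2. psd P1 \<longrightarrow> psd P2 \<longrightarrow> P1 \<preceq>\<^sub>L P2 \<longrightarrow> g \<mu> P1 \<le> g \<mu> P2)"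


section \<open>The closed loop under an estimate-history-affine policy\<close>

text \<open>\<open>xh_init\<close> is the prior estimate of the initial state \<open>x_init\<close>.\<close>

record ('a, 'n::finite, 'm::finite, 'l::finite, 'p::finite, 'q::finite) plant =
  prob_sp :: "'a measure"
  matA :: "nat \<Rightarrow> real^'n^'n"
  matB :: "nat \<Rightarrow> real^'m^'n"
  matG :: "nat \<Rightarrow> real^'l^'n"
  matC :: "nat \<Rightarrow> real^'n^'p"
  matD :: "nat \<Rightarrow> real^'q^'p"
  x_init :: "'a \<Rightarrow> real^'n"
  xh_init :: "'a \<Rightarrow> real^'n"
  w_noise :: "nat \<Rightarrow> 'a \<Rightarrow> real^'l"
  eta_noise :: "nat \<Rightarrow> 'a \<Rightarrow> real^'q"

definition vec_cond_exp :: "'a measure \<Rightarrow> 'a measure \<Rightarrow> ('a \<Rightarrow> real^'n) \<Rightarrow> 'a \<Rightarrow> real^'n" where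
  "vec_cond_exp M F X = (\<lambda>\<omega>. \<chi> i. real_cond_exp M F (\<lambda>\<omega>. X \<omega> $ i) \<omega>)"

definition gen_algebra :: "'a measure \<Rightarrow> ('a \<Rightarrow> real^'n) \<Rightarrow> ('a \<Rightarrow> real^'p) set \<Rightarrow> 'a measure" where
  "gen_algebra M X Ys = sigma (space M)
     ({X -` E \<inter> space M |E. E \<in> sets borel} \<union> (\<Union>Y\<in>Ys. {Y -` E \<inter> space M |E. E \<in> sets borel}))"

text \<open>For the policy with data \<open>(v, K)\<close>, the processes \<open>state\<close>, \<open>obs\<close>, \<open>est\<close> and \<open>ctrl\<close> are
  \<open>x\<close>, \<open>y\<close>, the estimate \<open>E[x\<^sub>k | \<F>\<^sub>k]\<close> and \<open>u\<close>, and \<open>filt\<close> is the filtration \<open>\<F>\<close>; all of them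
  depend on the policy through the feedback, hence the mutual recursion.\<close>

function
  state :: "('a,'n::finite,'m::finite,'l::finite,'p::finite,'q::finite) plant \<Rightarrow>
    (nat \<Rightarrow> real^'m) \<Rightarrow> (nat \<Rightarrow> nat \<Rightarrow> real^'n^'m) \<Rightarrow> nat \<Rightarrow> 'a \<Rightarrow> real^'n" and
  obs :: "('a,'n,'m,'l,'p,'q) plant \<Rightarrow>
    (nat \<Rightarrow> real^'m) \<Rightarrow> (nat \<Rightarrow> nat \<Rightarrow> real^'n^'m) \<Rightarrow> nat \<Rightarrow> 'a \<Rightarrow> real^'p" and
  filt :: "('a,'n,'m,'l,'p,'q) plant \<Rightarrow>
    (nat \<Rightarrow> real^'m) \<Rightarrow> (nat \<Rightarrow> nat \<Rightarrow> real^'n^'m) \<Rightarrow> nat \<Rightarrow> 'a measure" and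
  est :: "('a,'n,'m,'l,'p,'q) plant \<Rightarrow>
    (nat \<Rightarrow> real^'m) \<Rightarrow> (nat \<Rightarrow> nat \<Rightarrow> real^'n^'m) \<Rightarrow> nat \<Rightarrow> 'a \<Rightarrow> real^'n" and
  ctrl :: "('a,'n,'m,'l,'p,'q) plant \<Rightarrow>
    (nat \<Rightarrow> real^'m) \<Rightarrow> (nat \<Rightarrow> nat \<Rightarrow> real^'n^'m) \<Rightarrow> nat \<Rightarrow> 'a \<Rightarrow> real^'m"
where
  "state S v K 0 = x_init S"
| "state S v K (Suc k) =
     (\<lambda>\<omega>. matA S k *v state S v K k \<omega> + matB S k *v ctrl S v K k \<omega> + matG S k *v w_noise S k \<omega>)"
| "obs S v K k = (\<lambda>\<omega>. matC S k *v state S v K k \<omega> + matD S k *v eta_noise S k \<omega>)"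
| "filt S v K k = gen_algebra (prob_sp S) (xh_init S) ((\<lambda>j. obs S v K j) ` {..k})"
| "est S v K k = vec_cond_exp (prob_sp S) (filt S v K k) (state S v K k)"
| "ctrl S v K k =
     (\<lambda>\<omega>. v k + (\<Sum>i\<le>k. K k i *v (est S v K i \<omega> - integral\<^sup>L (prob_sp S) (est S v K i))))"
  by pat_completeness auto
termination
  by (relation "Wellfounded.measure (case_sum
        (case_sum (\<lambda>(S, v, K, k). 5 * k) (\<lambda>(S, v, K, k). 5 * k + 1))
        (case_sum (\<lambda>(S, v, K, k). 5 * k + 2)
          (case_sum (\<lambda>(S, v, K, k). 5 * k + 3) (\<lambda>(S, v, K, k). 5 * k + 4))))") auto

definition cost ::
  "('a,'n::finite,'m::finite,'l::finite,'p::finite,'q::finite) plant \<Rightarrow> nat \<Rightarrow>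
   (nat \<Rightarrow> real^'n^'n) \<Rightarrow> (nat \<Rightarrow> real^'m^'m) \<Rightarrow>
   (nat \<Rightarrow> real^'m) \<Rightarrow> (nat \<Rightarrow> nat \<Rightarrow> real^'n^'m) \<Rightarrow> real" where
  "cost S N Q R v K =
     (\<Sum>k\<le>N. integral\<^sup>L (prob_sp S) (\<lambda>\<omega>. state S v K k \<omega> \<bullet> (Q k *v state S v K k \<omega>))) +
     (\<Sum>k<N. integral\<^sup>L (prob_sp S) (\<lambda>\<omega>. ctrl S v K k \<omega> \<bullet> (R k *v ctrl S v K k \<omega>)))"

definition feasible ::
  "('a,'n::finite,'m::finite,'l::finite,'p::finite,'q::finite) plant \<Rightarrow> nat \<Rightarrow>
   (real^'n \<Rightarrow> real^'n^'n \<Rightarrow> real) \<Rightarrow> (real^'m \<Rightarrow> real^'m^'m \<Rightarrow> real) \<Rightarrow>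
   (nat \<Rightarrow> real^'m) \<Rightarrow> (nat \<Rightarrow> nat \<Rightarrow> real^'n^'m) \<Rightarrow> bool" where
  "feasible S N gx gu v K \<longleftrightarrow>
     (\<forall>k\<in>{1..N}. gx (integral\<^sup>L (prob_sp S) (state S v K k))
                       (cov (prob_sp S) (state S v K k) (state S v K k)) \<le> 0) \<and>
     (\<forall>k<N. gu (integral\<^sup>L (prob_sp S) (ctrl S v K k))
                (cov (prob_sp S) (ctrl S v K k) (ctrl S v K k)) \<le> 0)"

text \<open>Entries of \<open>v\<close> and \<open>K\<close> outside \<open>0 \<le> i \<le> k < N\<close> do not influence \<open>cost\<close> or \<open>feasible\<close>.\<close>

definition optimal ::
  "('a,'n::finite,'m::finite,'l::finite,'p::finite,'q::finite) plant \<Rightarrow> nat \<Rightarrow>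
   (nat \<Rightarrow> real^'n^'n) \<Rightarrow> (nat \<Rightarrow> real^'m^'m) \<Rightarrow>
   (real^'n \<Rightarrow> real^'n^'n \<Rightarrow> real) \<Rightarrow> (real^'m \<Rightarrow> real^'m^'m \<Rightarrow> real) \<Rightarrow>
   (nat \<Rightarrow> real^'m) \<Rightarrow> (nat \<Rightarrow> nat \<Rightarrow> real^'n^'m) \<Rightarrow> bool" where
  "optimal S N Q R gx gu v K \<longleftrightarrow> feasible S N gx gu v K \<and>
     (\<forall>v' K'. feasible S N gx gu v' K' \<longrightarrow> cost S N Q R v K \<le> cost S N Q R v' K')"

definition gainH ::
  "('a,'n::finite,'m::finite,'l::finite,'p::finite,'q::finite) plant \<Rightarrow>
   (nat \<Rightarrow> real^'m) \<Rightarrow> (nat \<Rightarrow> nat \<Rightarrow> real^'n^'m) \<Rightarrow> nat \<Rightarrow> real^'n^'m" where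
  "gainH S v K k = cov (prob_sp S) (ctrl S v K k) (est S v K k) **
     pinv (cov (prob_sp S) (est S v K k) (est S v K k))"

text \<open>The current-estimate-affine map of step \<open>k\<close>, with moments taken under the policy \<open>(v, K)\<close>.\<close>

definition policyM ::
  "('a,'n::finite,'m::finite,'l::finite,'p::finite,'q::finite) plant \<Rightarrow>
   (nat \<Rightarrow> real^'m) \<Rightarrow> (nat \<Rightarrow> nat \<Rightarrow> real^'n^'m) \<Rightarrow> nat \<Rightarrow> real^'n \<Rightarrow> real^'m" where
  "policyM S v K k z = v k + gainH S v K k *v (z - integral\<^sup>L (prob_sp S) (est S v K k))"

text \<open>Independence of two random variables, as independence of the generated sigma-algebras;
  \<open>indep_var\<close> would force \<open>X\<close> and \<open>Y\<close> to have the same type.\<close>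

definition indep_rv ::
  "'a measure \<Rightarrow> 'b measure \<Rightarrow> ('a \<Rightarrow> 'b) \<Rightarrow> 'c measure \<Rightarrow> ('a \<Rightarrow> 'c) \<Rightarrow> bool" where
  "indep_rv M MX X MY Y \<longleftrightarrow> X \<in> measurable M MX \<and> Y \<in> measurable M MY \<and>
     prob_space.indep_set M (sets (vimage_algebra (space M) X MX)) (sets (vimage_algebra (space M) Y MY))"

text \<open>The noises are indexed by \<open>k < N\<close>: the controls, the cost and the constraints involve no
  observation after time \<open>N - 1\<close>. The last two clauses make the pair of initial state and prior
  estimate, the process noise and the observation noise mutually independent.\<close>

definition lqg :: "('a,'n::finite,'m::finite,'l::finite,'p::finite,'q::finite) plant \<Rightarrow>
    nat \<Rightarrow> real^'n \<Rightarrow> real^'n^'n \<Rightarrow> bool" where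
  "lqg S N \<mu>0 P0 \<longleftrightarrow> (let M = prob_sp S in
     prob_space M \<and>
     psd P0 \<and> gaussian M (x_init S) \<mu>0 P0 \<and>
     (\<exists>\<mu> P. psd P \<and> gaussian M (xh_init S) \<mu> P) \<and>
     prob_space.indep_var M borel (xh_init S) borel (\<lambda>\<omega>. x_init S \<omega> - xh_init S \<omega>) \<and>
     (\<forall>k<N. gaussian M (w_noise S k) 0 (mat 1)) \<and>
     prob_space.indep_vars M (\<lambda>_. borel) (w_noise S) {..<N} \<and>
     (\<forall>k<N. gaussian M (eta_noise S k) 0 (mat 1)) \<and>
     prob_space.indep_vars M (\<lambda>_. borel) (eta_noise S) {..<N} \<and>
     indep_rv M
       (borel \<Otimes>\<^sub>M borel) (\<lambda>\<omega>. (x_init S \<omega>, xh_init S \<omega>))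
       (PiM {..<N} (\<lambda>_. borel)) (\<lambda>\<omega>. \<lambda>k\<in>{..<N}. w_noise S k \<omega>) \<and>
     indep_rv M
       ((borel \<Otimes>\<^sub>M borel) \<Otimes>\<^sub>M PiM {..<N} (\<lambda>_. borel))
         (\<lambda>\<omega>. ((x_init S \<omega>, xh_init S \<omega>), \<lambda>k\<in>{..<N}. w_noise S k \<omega>))
       (PiM {..<N} (\<lambda>_. borel)) (\<lambda>\<omega>. \<lambda>k\<in>{..<N}. eta_noise S k \<omega>))"

end

theory Submission
  imports Defs
begin

text \<open>The control enters the observations only through past observations, so the filtration \<open>\<F>\<^sub>k\<close> and
  the estimation errors are the same for every policy. Hence \<open>\<^bold>x\<^sub>k\<^sub>+\<^sub>1 = A \<^bold>x\<^sub>k + B u\<^sub>k + \<xi>\<^sub>k\<close> for the estimate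
  \<open>\<^bold>x\<^sub>k\<close>, with an innovation \<open>\<xi>\<^sub>k\<close> that is orthogonal to \<open>\<F>\<^sub>k\<close> and does not depend on the policy; the state
  obeys the same recursion with another such noise. Write \<open>u\<^sub>k - v\<^sub>k = H\<^sub>k (\<^bold>x\<^sub>k - E \<^bold>x\<^sub>k) + e\<^sub>k\<close>, where the
  regression residual \<open>e\<^sub>k\<close> is uncorrelated with \<open>\<^bold>x\<^sub>k\<close>. Dropping all \<open>e\<^sub>k\<close> keeps the means and, by induction
  on \<open>k\<close>, does not increase any covariance in the Loewner order, so the new policy is feasible. Its cost is
  smaller by at least \<open>\<Sum>k. E[e\<^sub>k \<bullet> R\<^sub>k e\<^sub>k]\<close>, and optimality forces \<open>e\<^sub>k = 0\<close> almost surely.\<close>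

subsection \<open>The pseudoinverse of a symmetric matrix\<close>

text \<open>Symmetry of \<open>X ** Y\<close> and \<open>X ** Z\<close> lets a transposition swap
  them in a product, so both are the same projection onto the range of \<open>X\<close>; likewise on
  the other side. Then \<open>Y ** X ** Y\<close> turns into \<open>Z ** X ** Z\<close>.\<close>

lemma is_pinv_unique:
  assumes "is_pinv X Y" and "is_pinv X Z"
  shows "Y = Z"
proof -
  have Y: "X ** Y ** X = X" "Y ** X ** Y = Y" "transpose (X ** Y) = X ** Y" "transpose (Y ** X) = Y ** X"
    and Z: "X ** Z ** X = X" "Z ** X ** Z = Z" "transpose (X ** Z) = X ** Z" "transpose (Z ** X) = Z ** X"
    using assms by (auto simp: is_pinv_def)
  have XY: "X ** Y = X ** Z"
  proof -
    have "X ** Y = transpose (X ** Z ** (X ** Y))"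
      using Y(3) Z(1) by (simp add: matrix_mul_assoc)
    also have "\<dots> = X ** Y ** (X ** Z)"
      by (simp only: matrix_transpose_mul[of "X ** Z" "X ** Y"] Y(3) Z(3))
    also have "\<dots> = X ** Z"
      using Y(1) by (simp add: matrix_mul_assoc)
    finally show ?thesis .
  qed
  have YX: "Y ** X = Z ** X"
  proof -
    have "Y ** X = transpose (Y ** X ** (Z ** X))"
      using Y(4) Z(1) by (simp add: matrix_mul_assoc[symmetric])
    also have "\<dots> = Z ** X ** (Y ** X)"
      by (simp only: matrix_transpose_mul[of "Y ** X" "Z ** X"] Y(4) Z(4))
    also have "\<dots> = Z ** X"
      using Y(1) by (simp add: matrix_mul_assoc[symmetric])
    finally show ?thesis .
  qed
  have "Y = Y ** X ** Y" using Y(2) by simp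
  also have "\<dots> = Z ** X ** Y" by (simp add: YX)
  also have "\<dots> = Z ** X ** Z" by (simp add: XY matrix_mul_assoc[symmetric])
  also have "\<dots> = Z" by (rule Z(2))
  finally show ?thesis .
qed

text \<open>A symmetric matrix is injective on its range, since \<open>P *v (P *v a) = 0\<close>
  forces \<open>P *v a\<close> to have norm zero. By dimension it maps its range onto itself, so
  every column of \<open>P\<close> has a preimage under \<open>P ** P\<close>; these preimages are
  the columns of \<open>X\<close>.\<close>

lemma symmetric_factor_square:
  fixes P :: "real^'n^'n"
  assumes "transpose P = P"
  obtains X where "P = P ** P ** X"
proof -
  have adj: "x \<bullet> (P *v y) = (P *v x) \<bullet> y" for x y
    using assms dot_lmul_matrix[of x P y] by (metis transpose_matrix_vector)
  let ?R = "range ((*v) P)"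
  have lin: "linear ((*v) P)" by simp
  have sub: "subspace ?R" by (simp add: linear_subspace_image)
  have "inj_on ((*v) P) ?R"
  proof (rule inj_onI)
    fix x y assume "x \<in> ?R" "y \<in> ?R" and eq: "P *v x = P *v y"
    then obtain a where a: "x - y = P *v a"
      by (metis imageE matrix_vector_mult_diff_distrib)
    have "P *v (P *v a) = 0" using eq a by (metis matrix_vector_mult_diff_distrib right_minus_eq)
    then have "(P *v a) \<bullet> (P *v a) = 0" using adj[of a "P *v a"] by simp
    then show "x = y" using a by simp
  qed
  then have "dim ((*v) P ` ?R) = dim ?R"
    using lin sub by (metis dim_image_eq span_eq_iff)
  moreover have "(*v) P ` ?R \<subseteq> ?R" by auto
  ultimately have R: "(*v) P ` ?R = ?R"
    using sub lin by (metis linear_subspace_image order_refl subspace_dim_equal)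
  have "\<exists>y. column j P = P *v (P *v y)" for j
  proof -
    have "column j P = P *v axis j 1" by (simp add: matrix_vector_mult_basis)
    then have "column j P \<in> (*v) P ` ?R" unfolding R by auto
    then show ?thesis by auto
  qed
  then obtain y where y: "\<And>j. column j P = P *v (P *v y j)" by metis
  define X where "X = (\<chi> i j. y j $ i)"
  have "P = P ** P ** X"
  proof (rule matrix_eq[THEN iffD2], rule allI)
    have "P *v axis j 1 = (P ** P ** X) *v axis j 1" for j
    proof -
      have "X *v axis j 1 = y j" unfolding matrix_vector_mult_basis by (simp add: X_def column_def)
      then show ?thesis
        using y[of j] by (metis matrix_vector_mul_assoc matrix_vector_mult_basis)
    qed
    then have "column j P = column j (P ** P ** X)" for j
      by (simp only: matrix_vector_mult_basis)
    then have "P = P ** P ** X" by (simp add: column_def vec_eq_iff)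
    then show "P *v x = (P ** P ** X) *v x" for x by simp
  qed
  then show thesis by (rule that)
qed

text \<open>If \<open>P = P\<^sup>2 X\<close> then the group inverse of the symmetric matrix \<open>P\<close> is \<open>X\<^sup>T P X\<close>, and for a symmetric
  matrix it coincides with the pseudoinverse.\<close>

lemma is_pinv_pinv_symmetric:
  fixes P :: "real^'n^'n"
  assumes sym: "transpose P = P"
  shows "is_pinv P (pinv P)"
proof -
  obtain X where X: "P = P ** P ** X" using symmetric_factor_square[OF sym] .
  define Z where "Z = transpose X"
  define Y where "Y = Z ** P ** X"
  have Z: "P = Z ** P ** P"
    using arg_cong[OF X, of transpose] by (simp add: Z_def matrix_transpose_mul sym matrix_mul_assoc)
  \<comment> \<open>Both sides equal \<open>Z ** P ** P ** X\<close>. The identity also makes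
    \<open>P ** X\<close> symmetric, as the Penrose equations require.\<close>
  have ZP: "Z ** P = P ** X"
    by (metis X Z matrix_mul_assoc)
  have PY: "P ** Y = P ** X"
    unfolding Y_def by (metis X ZP matrix_mul_assoc)
  have YP: "Y ** P = P ** X"
    unfolding Y_def by (metis Z ZP matrix_mul_assoc)
  have s: "transpose (P ** X) = P ** X"
    using ZP by (simp add: matrix_transpose_mul sym Z_def)
  have "is_pinv P Y"
    unfolding is_pinv_def PY YP
    using s X Z ZP by (metis Y_def PY matrix_mul_assoc)
  then show ?thesis
    unfolding pinv_def by (rule theI) (rule is_pinv_unique[OF _ \<open>is_pinv P Y\<close>])
qed

subsection \<open>Square-integrable random vectors\<close>

text \<open>The common regularity class: closed under sums, linear maps and conditional expectation,
  and the inner product of two members is integrable.\<close>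

definition sqint :: "'a measure \<Rightarrow> ('a \<Rightarrow> 'b::euclidean_space) \<Rightarrow> bool" where
  "sqint M X \<longleftrightarrow> X \<in> borel_measurable M \<and> integrable M (\<lambda>\<omega>. X \<omega> \<bullet> X \<omega>)"

lemma sqint_cong_AE:
  assumes "sqint M X" and "Y \<in> borel_measurable M" and "AE \<omega> in M. X \<omega> = Y \<omega>"
  shows "sqint M Y"
proof -
  have [measurable]: "X \<in> borel_measurable M" "Y \<in> borel_measurable M"
    using assms by (auto simp: sqint_def)
  have "integrable M (\<lambda>\<omega>. Y \<omega> \<bullet> Y \<omega>)"
    by (rule integrable_cong_AE_imp[of M "\<lambda>\<omega>. X \<omega> \<bullet> X \<omega>"]) (use assms in \<open>auto simp: sqint_def\<close>)
  then show ?thesis using assms by (simp add: sqint_def)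
qed

lemma sqint_inner_integrable:
  assumes "sqint M X" and "sqint M Y"
  shows "integrable M (\<lambda>\<omega>. X \<omega> \<bullet> Y \<omega>)"
proof (rule Bochner_Integration.integrable_bound)
  show "integrable M (\<lambda>\<omega>. X \<omega> \<bullet> X \<omega> + Y \<omega> \<bullet> Y \<omega>)" using assms by (auto simp: sqint_def)
  show "(\<lambda>\<omega>. X \<omega> \<bullet> Y \<omega>) \<in> borel_measurable M"
    using assms by (auto simp: sqint_def)
  have "\<bar>x \<bullet> y\<bar> \<le> x \<bullet> x + y \<bullet> y" for x y :: 'b
  proof -
    have "0 \<le> (x - y) \<bullet> (x - y)" "0 \<le> (x + y) \<bullet> (x + y)" by (rule inner_ge_zero)+
    moreover have "0 \<le> x \<bullet> x + y \<bullet> y" by simp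
    ultimately show ?thesis
      by (simp add: inner_add_left inner_add_right inner_diff_left inner_diff_right inner_commute[of y x])
  qed
  then show "AE \<omega> in M. norm (X \<omega> \<bullet> Y \<omega>) \<le> norm (X \<omega> \<bullet> X \<omega> + Y \<omega> \<bullet> Y \<omega>)"
    by (intro AE_I2) (metis abs_ge_self order_trans real_norm_def)
qed

lemma sqint_add:
  assumes "sqint M X" and "sqint M Y"
  shows "sqint M (\<lambda>\<omega>. X \<omega> + Y \<omega>)"
  using assms sqint_inner_integrable[OF assms] sqint_inner_integrable[OF assms(2,1)]
  by (auto simp: sqint_def inner_add_left inner_add_right)

lemma sqint_diff:
  assumes "sqint M X" and "sqint M Y"
  shows "sqint M (\<lambda>\<omega>. X \<omega> - Y \<omega>)"
  using assms sqint_inner_integrable[OF assms] sqint_inner_integrable[OF assms(2,1)]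
  by (auto simp: sqint_def inner_diff_left inner_diff_right)

lemma sqint_bounded_linear:
  fixes f :: "'b::euclidean_space \<Rightarrow> 'c::euclidean_space"
  assumes "bounded_linear f" and "sqint M X"
  shows "sqint M (\<lambda>\<omega>. f (X \<omega>))"
proof -
  obtain B where B: "\<And>x. norm (f x) \<le> norm x * B"
    using bounded_linear.bounded[OF assms(1)] by blast
  have m: "(\<lambda>\<omega>. f (X \<omega>)) \<in> borel_measurable M"
    by (rule borel_measurable_continuous_on[OF linear_continuous_on[OF assms(1)]])
      (use assms(2) in \<open>simp add: sqint_def\<close>)
  have "integrable M (\<lambda>\<omega>. f (X \<omega>) \<bullet> f (X \<omega>))"
  proof (rule Bochner_Integration.integrable_bound)
    show "integrable M (\<lambda>\<omega>. B\<^sup>2 * (X \<omega> \<bullet> X \<omega>))" using assms(2) by (simp add: sqint_def)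
    show "(\<lambda>\<omega>. f (X \<omega>) \<bullet> f (X \<omega>)) \<in> borel_measurable M" using m by simp
    have "f x \<bullet> f x \<le> B\<^sup>2 * (x \<bullet> x)" for x
      using power_mono[OF B[of x], of 2]
      by (simp add: power2_norm_eq_inner power_mult_distrib mult.commute)
    then show "AE \<omega> in M. norm (f (X \<omega>) \<bullet> f (X \<omega>)) \<le> norm (B\<^sup>2 * (X \<omega> \<bullet> X \<omega>))" by simp
  qed
  then show ?thesis using m by (simp add: sqint_def)
qed

lemma bounded_linear_matrix_vector: "bounded_linear (\<lambda>x. (A :: real^'n^'m) *v x)"
  by (simp add: linear_linear)

lemma sqint_matrix_vector: "sqint M X \<Longrightarrow> sqint M (\<lambda>\<omega>. (A :: real^'n^'m) *v X \<omega>)"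
  by (rule sqint_bounded_linear[OF bounded_linear_matrix_vector])

lemma sqint_vec_nth: "sqint M X \<Longrightarrow> sqint M (\<lambda>\<omega>. X \<omega> $ (i::'n::finite) :: real)"
  by (rule sqint_bounded_linear[OF bounded_linear_vec_nth])

lemma borel_measurable_vecI:
  fixes X :: "'a \<Rightarrow> real^'n"
  assumes "\<And>i. (\<lambda>\<omega>. X \<omega> $ i) \<in> borel_measurable M"
  shows "X \<in> borel_measurable M"
  by (subst borel_measurable_euclidean_space) (use assms in \<open>auto simp: Basis_vec_def inner_axis\<close>)

lemma borel_measurable_matrix_vector [measurable]:
  "X \<in> borel_measurable M \<Longrightarrow> (\<lambda>\<omega>. (A :: real^'n^'m) *v X \<omega>) \<in> borel_measurable M"
  by (rule borel_measurable_continuous_on[OF linear_continuous_on[OF bounded_linear_matrix_vector]])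

lemma borel_measurable_vec_nth_real [measurable]:
  "X \<in> borel_measurable M \<Longrightarrow> (\<lambda>\<omega>. X \<omega> $ (i::'n::finite) :: real) \<in> borel_measurable M"
  by (rule borel_measurable_continuous_on[OF linear_continuous_on[OF bounded_linear_vec_nth]])

lemma sqint_vecI:
  fixes X :: "'a \<Rightarrow> real^'n"
  assumes "\<And>i. sqint M (\<lambda>\<omega>. X \<omega> $ i)"
  shows "sqint M X"
  using assms by (auto simp: sqint_def inner_vec_def intro!: borel_measurable_vecI)

lemma (in finite_measure) sqint_const: "sqint M (\<lambda>_. c)"
  by (simp add: sqint_def)

lemma (in finite_measure) sqint_integrable:
  assumes "sqint M X"
  shows "integrable M X"
proof -
  have "integrable M (\<lambda>\<omega>. X \<omega> \<bullet> b)" for b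
    by (rule sqint_inner_integrable[OF assms sqint_const])
  then have "integrable M (\<lambda>\<omega>. \<Sum>b\<in>Basis. (X \<omega> \<bullet> b) *\<^sub>R b)" by auto
  then show ?thesis by (simp add: euclidean_representation)
qed

lemma integral_matrix_vector:
  "integrable M X \<Longrightarrow> (\<integral>\<omega>. (A :: real^'n^'m) *v X \<omega> \<partial>M) = A *v integral\<^sup>L M X"
  by (rule integral_bounded_linear[OF bounded_linear_matrix_vector])

lemma inner_matrix_vector_transpose:
  "x \<bullet> ((A :: real^'n^'m) *v y) = (transpose A *v x) \<bullet> y"
  using dot_lmul_matrix[of x A y] by simp

subsection \<open>Expectations of quadratic forms\<close>

definition qform :: "real^'n^'n \<Rightarrow> real^'n \<Rightarrow> real" where
  "qform Q x = x \<bullet> (Q *v x)"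

lemma qform_matrix_vector: "qform Q ((A :: real^'n^'m) *v x) = qform (transpose A ** Q ** A) x"
  using inner_matrix_vector_transpose[of x "transpose A" "Q *v (A *v x)"]
  by (simp add: qform_def del: transpose_matrix_vector flip: matrix_vector_mul_assoc)

lemma psd_congruence:
  assumes "psd Q"
  shows "psd (transpose (A :: real^'n^'m) ** Q ** A)"
proof -
  have "0 \<le> x \<bullet> ((transpose A ** Q ** A) *v x)" for x
    using assms qform_matrix_vector[of Q A x] by (metis psd_def qform_def)
  then show ?thesis
    using assms by (simp add: psd_def matrix_transpose_mul matrix_mul_assoc)
qed

lemma psd_qform_nonneg: "psd Q \<Longrightarrow> 0 \<le> qform Q x"
  by (simp add: psd_def qform_def)

lemma qform_add:
  "transpose Q = Q \<Longrightarrow> qform Q (x + y) = qform Q x + qform Q y + 2 * (x \<bullet> (Q *v y))"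
  using inner_matrix_vector_transpose[of x Q y] inner_commute[of y "Q *v x"]
  by (simp add: qform_def matrix_vector_right_distrib inner_add_left inner_add_right)

lemma integrable_qform: "sqint M X \<Longrightarrow> integrable M (\<lambda>\<omega>. qform Q (X \<omega>))"
  unfolding qform_def by (intro sqint_inner_integrable sqint_matrix_vector)

lemma integral_qform_add:
  assumes X: "sqint M X" and Y: "sqint M Y" and Q: "transpose Q = Q"
    and orth: "(\<integral>\<omega>. X \<omega> \<bullet> (Q *v Y \<omega>) \<partial>M) = 0"
  shows "(\<integral>\<omega>. qform Q (X \<omega> + Y \<omega>) \<partial>M) = (\<integral>\<omega>. qform Q (X \<omega>) \<partial>M) + (\<integral>\<omega>. qform Q (Y \<omega>) \<partial>M)"
  using integrable_qform[OF X, of Q] integrable_qform[OF Y, of Q]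
    sqint_inner_integrable[OF X sqint_matrix_vector[OF Y, of Q]] orth
  by (simp add: qform_add[OF Q])

text \<open>For square-integrable \<open>X\<close> this is the trace of
  \<open>Q ** cov M X X\<close>. Covariances are compared through these scalars, with
  \<open>Q\<close> ranging over the psd weights.\<close>

definition var_qform :: "'a measure \<Rightarrow> real^'n^'n \<Rightarrow> ('a \<Rightarrow> real^'n) \<Rightarrow> real" where
  "var_qform M Q X = (\<integral>\<omega>. qform Q (X \<omega> - integral\<^sup>L M X) \<partial>M)"

text \<open>The cross term vanishes because the centred vector has mean zero. The cost thus splits
  into variances and a part that depends on the means only.\<close>

lemma (in prob_space) integral_qform_centre:
  assumes X: "sqint M X" and Q: "transpose Q = Q"
  shows "(\<integral>\<omega>. qform Q (X \<omega>) \<partial>M) = var_qform M Q X + qform Q (integral\<^sup>L M X)"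
proof -
  let ?m = "integral\<^sup>L M X"
  have i: "integrable M X" by (rule sqint_integrable[OF X])
  have c: "sqint M (\<lambda>\<omega>. X \<omega> - ?m)" by (intro sqint_diff X sqint_const)
  have "(\<integral>\<omega>. (X \<omega> - ?m) \<bullet> (Q *v ?m) \<partial>M) = (\<integral>\<omega>. X \<omega> - ?m \<partial>M) \<bullet> (Q *v ?m)"
    by (rule integral_inner_left) (use i in simp)
  also have "\<dots> = 0" using i by (simp add: prob_space)
  finally show ?thesis
    using integral_qform_add[OF c sqint_const Q, of ?m] by (simp add: var_qform_def prob_space)
qed

text \<open>With the rank-one weight \<open>a a^T\<close> the quadratic form of a vector is the
  square of its inner product with \<open>a\<close>; this links the covariance matrix to scalar
  variances.\<close>

lemma (in prob_space) qform_cov: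
  assumes X: "sqint M X"
  shows "qform (cov M X X) a = var_qform M (\<chi> i j. a $ i * a $ j) X"
proof -
  let ?c = "\<lambda>\<omega>. X \<omega> - integral\<^sup>L M X"
  have c: "sqint M ?c" by (intro sqint_diff X sqint_const)
  have int: "integrable M (\<lambda>\<omega>. ?c \<omega> $ i * ?c \<omega> $ j)" for i j
    using sqint_inner_integrable[OF sqint_vec_nth[OF c] sqint_vec_nth[OF c], of i j] by simp
  have "qform (cov M X X) a = (\<Sum>i\<in>UNIV. \<Sum>j\<in>UNIV. a $ i * a $ j * (\<integral>\<omega>. ?c \<omega> $ i * ?c \<omega> $ j \<partial>M))"
    unfolding qform_def cov_def inner_vec_def matrix_vector_mult_def
    by (simp add: sum_distrib_left mult_ac)
  also have "\<dots> = (\<integral>\<omega>. (\<Sum>i\<in>UNIV. \<Sum>j\<in>UNIV. a $ i * a $ j * (?c \<omega> $ i * ?c \<omega> $ j)) \<partial>M)"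
    by (simp add: int del: vector_minus_component)
  also have "\<dots> = var_qform M (\<chi> i j. a $ i * a $ j) X"
    unfolding var_qform_def qform_def inner_vec_def matrix_vector_mult_def
    by (simp add: sum_distrib_left mult_ac)
  finally show ?thesis .
qed

lemma psd_outer: "psd (\<chi> i j. a $ i * a $ j :: real^'n^'n)"
proof -
  have "x \<bullet> ((\<chi> i j. a $ i * a $ j) *v x) = (a \<bullet> x)\<^sup>2" for x
    unfolding inner_vec_def matrix_vector_mult_def power2_eq_square
    by (simp add: sum_product) (simp add: sum_distrib_left mult_ac)
  then show ?thesis by (simp add: psd_def transpose_def vec_eq_iff mult.commute)
qed

lemma transpose_cov: "transpose (cov M X X) = cov M X X"
  by (simp add: cov_def transpose_def vec_eq_iff mult.commute)

lemma var_qform_nonneg: "psd Q \<Longrightarrow> 0 \<le> var_qform M Q X"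
  unfolding var_qform_def by (intro integral_nonneg_AE AE_I2 psd_qform_nonneg)

lemma (in prob_space) psd_cov: "sqint M X \<Longrightarrow> psd (cov M X X)"
  using qform_cov[of X] var_qform_nonneg[OF psd_outer, of M _ X]
  by (auto simp: psd_def transpose_cov qform_def)

lemma (in prob_space) loewner_le_cov:
  assumes X: "sqint M X" and Y: "sqint M Y"
    and le: "\<And>Q. psd Q \<Longrightarrow> var_qform M Q X \<le> var_qform M Q Y"
  shows "cov M X X \<preceq>\<^sub>L cov M Y Y"
proof -
  have "0 \<le> x \<bullet> ((cov M Y Y - cov M X X) *v x)" for x
    using qform_cov[OF X, of x] qform_cov[OF Y, of x] le[OF psd_outer, of x]
    by (simp add: qform_def matrix_vector_mult_diff_rdistrib inner_diff_right)
  moreover have "transpose (cov M Y Y - cov M X X) = cov M Y Y - cov M X X"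
    by (simp add: cov_def transpose_def vec_eq_iff mult.commute)
  ultimately show ?thesis by (simp add: loewner_le_def psd_def)
qed

subsection \<open>Orthogonality to a sub-sigma-algebra\<close>

text \<open>For square-integrable \<open>X\<close> and a sub-sigma-algebra \<open>F\<close> this
  says that the conditional expectation of \<open>X\<close> given \<open>F\<close> is zero, in a
  form that passes directly to sums, linear images and smaller sigma-algebras.\<close>

definition orth :: "'a measure \<Rightarrow> 'a measure \<Rightarrow> ('a \<Rightarrow> real^'n) \<Rightarrow> bool" where
  "orth M F X \<longleftrightarrow> (\<forall>Z. sqint M Z \<longrightarrow> Z \<in> borel_measurable F \<longrightarrow> (\<integral>\<omega>. Z \<omega> \<bullet> X \<omega> \<partial>M) = 0)"

lemma orth_mono:
  assumes "orth M G X" and "sets F \<subseteq> sets G" and "space F = space G"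
  shows "orth M F X"
proof -
  have "Z \<in> borel_measurable G" if "Z \<in> borel_measurable F" for Z :: "'a \<Rightarrow> real^'c"
    using that assms(2,3) by (auto simp: measurable_def)
  then show ?thesis using assms(1) by (auto simp: orth_def)
qed

lemma orth_add:
  assumes "orth M F X" and "orth M F Y" and "sqint M X" and "sqint M Y"
  shows "orth M F (\<lambda>\<omega>. X \<omega> + Y \<omega>)"
  using assms by (auto simp: orth_def inner_add_right sqint_inner_integrable)

lemma orth_diff:
  assumes "orth M F X" and "orth M F Y" and "sqint M X" and "sqint M Y"
  shows "orth M F (\<lambda>\<omega>. X \<omega> - Y \<omega>)"
  using assms by (auto simp: orth_def inner_diff_right sqint_inner_integrable)

lemma orth_matrix_vector:
  assumes "orth M F X"
  shows "orth M F (\<lambda>\<omega>. (A :: real^'n^'m) *v X \<omega>)"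
  using assms unfolding orth_def inner_matrix_vector_transpose
  by (auto intro: sqint_matrix_vector borel_measurable_matrix_vector simp del: transpose_matrix_vector)

text \<open>Constants are measurable for every \<open>F\<close>, so the mean itself can serve as the
  test vector.\<close>

lemma (in prob_space) orth_integral_eq_0:
  assumes "orth M F X" and "sqint M X"
  shows "integral\<^sup>L M X = 0"
proof -
  have "integral\<^sup>L M X \<bullet> integral\<^sup>L M X = (\<integral>\<omega>. integral\<^sup>L M X \<bullet> X \<omega> \<partial>M)"
    using sqint_integrable[OF assms(2)] by simp
  also have "\<dots> = 0" using assms(1) by (simp add: orth_def sqint_const)
  finally show ?thesis by simp
qed

lemma integral_qform_add_orth:
  assumes "sqint M X" and "X \<in> borel_measurable F" and "sqint M Y" and "orth M F Y" and "transpose Q = Q"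
  shows "(\<integral>\<omega>. qform Q (X \<omega> + Y \<omega>) \<partial>M) = (\<integral>\<omega>. qform Q (X \<omega>) \<partial>M) + (\<integral>\<omega>. qform Q (Y \<omega>) \<partial>M)"
  using assms orth_matrix_vector[OF assms(4), of Q] by (intro integral_qform_add) (auto simp: orth_def)

subsection \<open>Conditional expectation of random vectors\<close>

lemma vec_cond_exp_measurable: "vec_cond_exp M F X \<in> borel_measurable F"
  by (rule borel_measurable_vecI) (simp add: vec_cond_exp_def)

context prob_space
begin

lemma sigma_finite_subalgebra_prob:
  assumes "subalgebra M F"
  shows "sigma_finite_subalgebra M F"
proof -
  interpret finite_measure_subalgebra M F using assms by unfold_locales
  show ?thesis by unfold_locales
qed

text \<open>Conditional Jensen inequality for the square, applied to each coordinate.\<close>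

lemma sqint_vec_cond_exp:
  assumes F: "subalgebra M F" and X: "sqint M X"
  shows "sqint M (vec_cond_exp M F X)"
proof (rule sqint_vecI)
  interpret sigma_finite_subalgebra M F by (rule sigma_finite_subalgebra_prob[OF F])
  fix i
  have Xi: "sqint M (\<lambda>\<omega>. X \<omega> $ i)" by (rule sqint_vec_nth[OF X])
  have "integrable M (\<lambda>\<omega>. (real_cond_exp M F (\<lambda>\<omega>. X \<omega> $ i) \<omega>)\<^sup>2)"
    by (rule integrable_convex_cond_exp[of "\<lambda>\<omega>. X \<omega> $ i" UNIV])
      (use Xi sqint_integrable[OF Xi] in \<open>auto simp: sqint_def power2_eq_square convex_power2[unfolded power2_eq_square]\<close>)
  then show "sqint M (\<lambda>\<omega>. vec_cond_exp M F X \<omega> $ i)"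
    by (simp add: sqint_def vec_cond_exp_def power2_eq_square)
qed

text \<open>Conditional expectation is the L2 projection: coordinatewise, a measurable factor
  \<open>Z\<close> can be moved through it under the integral.\<close>

lemma orth_vec_cond_exp:
  assumes F: "subalgebra M F" and X: "sqint M X"
  shows "orth M F (\<lambda>\<omega>. X \<omega> - vec_cond_exp M F X \<omega>)"
  unfolding orth_def
proof (intro allI impI)
  interpret sigma_finite_subalgebra M F by (rule sigma_finite_subalgebra_prob[OF F])
  fix Z :: "'a \<Rightarrow> real^'b" assume Z: "sqint M Z" and ZF: "Z \<in> borel_measurable F"
  have int: "integrable M (\<lambda>\<omega>. Z \<omega> $ i * X \<omega> $ i)" for i
    using sqint_inner_integrable[OF sqint_vec_nth[OF Z] sqint_vec_nth[OF X], of i i] by simp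
  have Zi: "(\<lambda>\<omega>. Z \<omega> $ i) \<in> borel_measurable F" for i using ZF by measurable
  have Xi: "(\<lambda>\<omega>. X \<omega> $ i) \<in> borel_measurable M" for i
    using sqint_vec_nth[OF X, of i] by (simp add: sqint_def)
  note c = real_cond_exp_intg[OF int Zi Xi]
  show "(\<integral>\<omega>. Z \<omega> \<bullet> (X \<omega> - vec_cond_exp M F X \<omega>) \<partial>M) = 0"
    using int c by (simp add: inner_vec_def vec_cond_exp_def right_diff_distrib)
qed

lemma vec_cond_exp_add_measurable:
  assumes F: "subalgebra M F" and X: "sqint M X" and Y: "sqint M Y" and YF: "Y \<in> borel_measurable F"
  shows "AE \<omega> in M. vec_cond_exp M F (\<lambda>\<omega>. X \<omega> + Y \<omega>) \<omega> = vec_cond_exp M F X \<omega> + Y \<omega>"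
proof -
  interpret sigma_finite_subalgebra M F by (rule sigma_finite_subalgebra_prob[OF F])
  have "AE \<omega> in M. real_cond_exp M F (\<lambda>\<omega>. X \<omega> $ i + Y \<omega> $ i) \<omega> =
      real_cond_exp M F (\<lambda>\<omega>. X \<omega> $ i) \<omega> + Y \<omega> $ i" for i
  proof -
    have "integrable M (\<lambda>\<omega>. X \<omega> $ i)" "integrable M (\<lambda>\<omega>. Y \<omega> $ i)"
      by (intro sqint_integrable sqint_vec_nth X Y)+
    from real_cond_exp_add[OF this] real_cond_exp_F_meas[OF this(2)] YF
    show ?thesis by (auto elim!: eventually_elim2)
  qed
  then have "AE \<omega> in M. \<forall>i. real_cond_exp M F (\<lambda>\<omega>. X \<omega> $ i + Y \<omega> $ i) \<omega> =
      real_cond_exp M F (\<lambda>\<omega>. X \<omega> $ i) \<omega> + Y \<omega> $ i"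
    by (subst AE_all_countable) auto
  then show ?thesis
    by eventually_elim (simp add: vec_cond_exp_def vec_eq_iff)
qed

end

subsection \<open>The filtration does not depend on the policy\<close>

declare state.simps [simp del] obs.simps [simp del] filt.simps [simp del] est.simps [simp del]
  ctrl.simps [simp del]

section \<open>The sigma-algebra generated by the prior estimate and the observations\<close>

lemma space_gen_algebra [simp]: "space (gen_algebra M X Ys) = space M"
  unfolding gen_algebra_def by (rule space_measure_of) auto

lemma sets_gen_algebra:
  "sets (gen_algebra M X Ys) = sigma_sets (space M)
     ({X -` E \<inter> space M |E. E \<in> sets borel} \<union> (\<Union>Y\<in>Ys. {Y -` E \<inter> space M |E. E \<in> sets borel}))"
  unfolding gen_algebra_def by (rule sets_measure_of) auto

lemma gen_algebra_measurable_base: "X \<in> borel_measurable (gen_algebra M X Ys)"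
  by (auto simp: measurable_def sets_gen_algebra)

lemma gen_algebra_measurable: "Y \<in> Ys \<Longrightarrow> Y \<in> borel_measurable (gen_algebra M X Ys)"
  by (auto simp: measurable_def sets_gen_algebra)

lemma gen_algebra_least:
  assumes "space G = space M" and "X \<in> borel_measurable G"
    and "\<And>Y. Y \<in> Ys \<Longrightarrow> Y \<in> borel_measurable G"
  shows "sets (gen_algebra M X Ys) \<subseteq> sets G"
  unfolding sets_gen_algebra assms(1)[symmetric]
  by (rule sets.sigma_sets_subset) (use assms in \<open>auto dest: measurable_sets\<close>)

lemma borel_measurable_mono:
  "f \<in> measurable F N \<Longrightarrow> sets F \<subseteq> sets G \<Longrightarrow> space F = space G \<Longrightarrow> f \<in> measurable G N"
  by (auto simp: measurable_def)

lemma space_filt [simp]: "space (filt S v K k) = space (prob_sp S)"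
  by (simp add: filt.simps)

lemma filt_measurable_prior: "xh_init S \<in> borel_measurable (filt S v K k)"
  unfolding filt.simps by (rule gen_algebra_measurable_base)

lemma filt_measurable_obs: "j \<le> k \<Longrightarrow> obs S v K j \<in> borel_measurable (filt S v K k)"
  unfolding filt.simps by (rule gen_algebra_measurable) auto

lemma filt_least:
  assumes "space G = space (prob_sp S)" and "xh_init S \<in> borel_measurable G"
    and "\<And>j. j \<le> k \<Longrightarrow> obs S v K j \<in> borel_measurable G"
  shows "sets (filt S v K k) \<subseteq> sets G"
  unfolding filt.simps using assms by (intro gen_algebra_least) auto

lemma filt_mono: "j \<le> k \<Longrightarrow> sets (filt S v K j) \<subseteq> sets (filt S v K k)"
  by (rule filt_least) (auto intro: filt_measurable_prior filt_measurable_obs)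

lemma est_measurable: "i \<le> k \<Longrightarrow> est S v K i \<in> borel_measurable (filt S v K k)"
  unfolding est.simps
  by (rule borel_measurable_mono[OF vec_cond_exp_measurable filt_mono]) auto

lemma ctrl_measurable: "i \<le> k \<Longrightarrow> ctrl S v K i \<in> borel_measurable (filt S v K k)"
  unfolding ctrl.simps
  by (intro borel_measurable_add borel_measurable_const borel_measurable_sum
      borel_measurable_matrix_vector borel_measurable_diff est_measurable) auto

text \<open>The zero-state response to the controls: by superposition, what the policy adds to the
  uncontrolled state.\<close>

primrec drift :: "('a,'n::finite,'m::finite,'l::finite,'p::finite,'q::finite) plant \<Rightarrow>
    (nat \<Rightarrow> real^'m) \<Rightarrow> (nat \<Rightarrow> nat \<Rightarrow> real^'n^'m) \<Rightarrow> nat \<Rightarrow> 'a \<Rightarrow> real^'n" where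
  "drift S v K 0 = (\<lambda>\<omega>. 0)"
| "drift S v K (Suc k) = (\<lambda>\<omega>. matA S k *v drift S v K k \<omega> + matB S k *v ctrl S v K k \<omega>)"

text \<open>The uncontrolled plant is encoded as the closed loop under the zero policy, so that all
  facts about closed loops apply to it.\<close>

abbreviation (input) "free_state S \<equiv> state S (\<lambda>_. 0) (\<lambda>_ _. 0)"
abbreviation (input) "free_obs S \<equiv> obs S (\<lambda>_. 0) (\<lambda>_ _. 0)"
abbreviation (input) "free_filt S \<equiv> filt S (\<lambda>_. 0) (\<lambda>_ _. 0)"
abbreviation (input) "free_est S \<equiv> est S (\<lambda>_. 0) (\<lambda>_ _. 0)"

lemma free_ctrl: "ctrl S (\<lambda>_. 0) (\<lambda>_ _. 0) k = (\<lambda>\<omega>. 0)"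
  by (simp add: ctrl.simps)

lemma state_eq_free_state: "state S v K k \<omega> = free_state S k \<omega> + drift S v K k \<omega>"
  by (induction k) (simp_all add: state.simps free_ctrl matrix_vector_right_distrib)

lemma obs_eq_free_obs: "obs S v K k \<omega> = free_obs S k \<omega> + matC S k *v drift S v K k \<omega>"
  by (simp add: obs.simps state_eq_free_state[of S v K k] matrix_vector_right_distrib)

text \<open>The bound \<open>Suc j\<close> records the one-step delay: the response at
  \<open>Suc j\<close> involves controls up to time \<open>j\<close> only. This delay breaks the
  circle between control and information.\<close>

lemma drift_measurable: "k \<le> Suc j \<Longrightarrow> drift S v K k \<in> borel_measurable (filt S v K j)"
  by (induction k)
    (auto intro!: borel_measurable_add borel_measurable_matrix_vector ctrl_measurable)

text \<open>Controlled and free observations at \<open>j\<close> differ by \<open>matC S j\<close>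
  applied to the drift, which is known from the filtration at \<open>j - 1\<close> (and is zero for
  \<open>j = 0\<close>). By induction that filtration is the free one, so each family of
  observations is measurable for the other filtration.\<close>

lemma sets_filt_eq_free: "sets (filt S v K k) = sets (free_filt S k)"
proof (induction k rule: less_induct)
  case (less k)
  have d: "drift S v K j \<in> borel_measurable (filt S v K k)"
      "drift S v K j \<in> borel_measurable (free_filt S k)" if "j \<le> k" for j
  proof -
    show "drift S v K j \<in> borel_measurable (filt S v K k)"
      using that by (intro drift_measurable) simp
    show "drift S v K j \<in> borel_measurable (free_filt S k)"
    proof (cases j)
      case (Suc i)
      have "drift S v K j \<in> borel_measurable (filt S v K i)" by (rule drift_measurable) (simp add: Suc)
      moreover have "sets (filt S v K i) \<subseteq> sets (free_filt S k)"
        using less[of i] filt_mono[of i k S] that Suc by auto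
      ultimately show ?thesis by (rule borel_measurable_mono) simp
    qed simp
  qed
  show ?case
  proof (rule antisym; rule filt_least)
    fix j assume j: "j \<le> k"
    have "(\<lambda>\<omega>. free_obs S j \<omega> + matC S j *v drift S v K j \<omega>) \<in> borel_measurable (free_filt S k)"
      by (intro borel_measurable_add filt_measurable_obs borel_measurable_matrix_vector d j)
    then show "obs S v K j \<in> borel_measurable (free_filt S k)"
      by (simp flip: obs_eq_free_obs)
    have "(\<lambda>\<omega>. obs S v K j \<omega> - matC S j *v drift S v K j \<omega>) \<in> borel_measurable (filt S v K k)"
      by (intro borel_measurable_diff filt_measurable_obs borel_measurable_matrix_vector d j)
    then show "free_obs S j \<in> borel_measurable (filt S v K k)"
      by (simp add: obs_eq_free_obs[of S v K])
  qed (auto intro: filt_measurable_prior)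
qed

text \<open>Conditional expectation takes the filtration as a measure, so equality of the measures
  is wanted for rewriting \<open>est\<close>; a measure built by \<open>sigma\<close> is determined
  by its space and the generated sets.\<close>

lemma filt_eq_free: "filt S v K k = free_filt S k"
proof -
  have "sigma_sets (space (prob_sp S)) ({xh_init S -` E \<inter> space (prob_sp S) |E. E \<in> sets borel} \<union>
        (\<Union>Y\<in>(\<lambda>j. obs S v K j) ` {..k}. {Y -` E \<inter> space (prob_sp S) |E. E \<in> sets borel})) =
      sigma_sets (space (prob_sp S)) ({xh_init S -` E \<inter> space (prob_sp S) |E. E \<in> sets borel} \<union>
        (\<Union>Y\<in>(\<lambda>j. free_obs S j) ` {..k}. {Y -` E \<inter> space (prob_sp S) |E. E \<in> sets borel}))"
    using sets_filt_eq_free[of S v K k] unfolding filt.simps sets_gen_algebra .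
  then show ?thesis
    unfolding filt.simps gen_algebra_def by (rule sigma_eqI[rotated 2]) auto
qed

subsection \<open>Consequences of the noise model\<close>

context prob_space
begin

text \<open>Each coordinate is the functional \<open>axis i 1\<close>: with zero variance it is
  almost surely constant, otherwise the normal density has a finite second moment.\<close>

lemma gaussian_sqint:
  fixes X :: "'a \<Rightarrow> real^'n"
  assumes X: "gaussian M X \<mu> P" and P: "psd P"
  shows "sqint M X"
proof (rule sqint_vecI)
  fix i
  let ?a = "axis i 1 :: real^'n"
  let ?s = "?a \<bullet> (P *v ?a)"
  have m: "(\<lambda>\<omega>. X \<omega> $ i) \<in> borel_measurable M"
    using X by (auto simp: gaussian_def intro: borel_measurable_vec_nth_real)
  have a: "?a \<bullet> x = x $ i" for x :: "real^'n" by (simp add: inner_axis')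
  show "sqint M (\<lambda>\<omega>. X \<omega> $ i)"
  proof (cases "?s = 0")
    case True
    then have "AE \<omega> in M. \<mu> $ i = X \<omega> $ i"
      using X unfolding gaussian_def a by (metis (mono_tags, lifting) AE_mp AE_I2 a)
    then show ?thesis by (rule sqint_cong_AE[OF sqint_const m])
  next
    case False
    \<comment> \<open>Positive semidefiniteness excludes a negative value, so \<open>r\<close> below
      is a genuine standard deviation.\<close>
    then have s: "0 < ?s" using P by (metis order_le_less psd_def)
    define r where "r = sqrt ?s"
    have r: "0 < r" using s by (simp add: r_def)
    have "distributed M lborel (\<lambda>\<omega>. ?a \<bullet> X \<omega>) (normal_density (?a \<bullet> \<mu>) r)"
      using X False unfolding gaussian_def r_def by meson
    then have "distributed M lborel (\<lambda>\<omega>. X \<omega> $ i) (normal_density (\<mu> $ i) r)"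
      unfolding a .
    from distributed_integrable[OF this, of "\<lambda>x. (x - \<mu> $ i)\<^sup>2"] integrable_normal_moment[OF r, of "\<mu> $ i" 2]
    have "sqint M (\<lambda>\<omega>. X \<omega> $ i - \<mu> $ i)" using m by (simp add: sqint_def power2_eq_square)
    from sqint_add[OF this sqint_const, of "\<mu> $ i"] show ?thesis by simp
  qed
qed

lemma standard_gaussian_expectation:
  fixes X :: "'a \<Rightarrow> real^'n"
  assumes X: "gaussian M X 0 (mat 1)"
  shows "expectation (\<lambda>\<omega>. X \<omega> $ i) = 0"
proof -
  let ?a = "axis i 1 :: real^'n"
  have a: "?a \<bullet> x = x $ i" for x :: "real^'n" by (simp add: inner_axis')
  have "?a \<bullet> (mat 1 *v ?a) = 1" by (simp add: inner_axis')
  then have "distributed M lborel (\<lambda>\<omega>. X \<omega> $ i) (normal_density 0 1)"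
    using X unfolding gaussian_def by (auto simp: inner_axis' dest!: spec[of _ ?a])
  then show ?thesis by (rule normal_distributed_expectation[rotated]) simp
qed

lemma indep_set_mono:
  "indep_set A B \<Longrightarrow> A' \<subseteq> A \<Longrightarrow> B' \<subseteq> B \<Longrightarrow> indep_set A' B'"
  unfolding indep_sets2_eq by blast

end

lemma lqgD:
  assumes "lqg S N \<mu>0 P0"
  shows "prob_space (prob_sp S)"
    and "psd P0" and "gaussian (prob_sp S) (x_init S) \<mu>0 P0"
    and "\<And>k. k < N \<Longrightarrow> gaussian (prob_sp S) (w_noise S k) 0 (mat 1)"
    and "prob_space.indep_vars (prob_sp S) (\<lambda>_. borel) (w_noise S) {..<N}"
    and "\<And>k. k < N \<Longrightarrow> gaussian (prob_sp S) (eta_noise S k) 0 (mat 1)"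
    and "indep_rv (prob_sp S)
       (borel \<Otimes>\<^sub>M borel) (\<lambda>\<omega>. (x_init S \<omega>, xh_init S \<omega>))
       (PiM {..<N} (\<lambda>_. borel)) (\<lambda>\<omega>. \<lambda>k\<in>{..<N}. w_noise S k \<omega>)"
    and "indep_rv (prob_sp S)
       ((borel \<Otimes>\<^sub>M borel) \<Otimes>\<^sub>M PiM {..<N} (\<lambda>_. borel))
         (\<lambda>\<omega>. ((x_init S \<omega>, xh_init S \<omega>), \<lambda>k\<in>{..<N}. w_noise S k \<omega>))
       (PiM {..<N} (\<lambda>_. borel)) (\<lambda>\<omega>. \<lambda>k\<in>{..<N}. eta_noise S k \<omega>)"
    and "xh_init S \<in> borel_measurable (prob_sp S)"
  using assms by (simp_all add: lqg_def Let_def) (auto simp: gaussian_def)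

locale lqg_plant =
  fixes S :: "('a,'n::finite,'m::finite,'l::finite,'p::finite,'q::finite) plant"
    and N :: nat and \<mu>0 :: "real^'n" and P0 :: "real^'n^'n"
  assumes lqg: "lqg S N \<mu>0 P0"
begin

abbreviation "M \<equiv> prob_sp S"

sublocale prob_space M by (rule lqgD[OF lqg])

text \<open>\<open>w\<^sub>k\<close> is independent of the triple of initial data, earlier process noise and observation noise,
  and the uncontrolled filtration at time \<open>k\<close> is generated by functions of that triple.\<close>

lemma noise_indep_filt:
  assumes k: "k < N"
  shows "indep_set (sets (free_filt S k)) (sets (vimage_algebra (space M) (w_noise S k) borel))"
proof -
  let ?X = "\<lambda>\<omega>. (x_init S \<omega>, xh_init S \<omega>)"
  let ?W = "\<lambda>J \<omega>. \<lambda>j\<in>J. w_noise S j \<omega>"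
  let ?E = "\<lambda>\<omega>. \<lambda>j\<in>{..<N}. eta_noise S j \<omega>"
  let ?Pi = "\<lambda>J. PiM J (\<lambda>_::nat. borel)"
  define VX where "VX = vimage_algebra (space M) ?X (borel \<Otimes>\<^sub>M borel)"
  define VW where "VW J = vimage_algebra (space M) (?W J) (?Pi J)" for J
  define VE where "VE = vimage_algebra (space M) ?E (?Pi {..<N})"
  define VXW where "VXW = vimage_algebra (space M) (\<lambda>\<omega>. (?X \<omega>, ?W {..<N} \<omega>)) ((borel \<Otimes>\<^sub>M borel) \<Otimes>\<^sub>M ?Pi {..<N})"
  define Vw where "Vw = vimage_algebra (space M) (w_noise S k) borel"
  note V = VX_def VW_def VE_def VXW_def Vw_def
  have sp [simp]: "space VX = space M" "space (VW J) = space M" "space VE = space M"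
      "space VXW = space M" "space Vw = space M" for J
    by (simp_all add: V)
  have iX: "indep_set (sets VX) (sets (VW {..<N}))" and iE: "indep_set (sets VXW) (sets VE)"
    using lqgD(7,8)[OF lqg] by (auto simp: indep_rv_def V)
  have iw: "indep_set (sets (VW {..<k})) (sets (VW {k}))"
    using indep_var_restrict[OF lqgD(5)[OF lqg], of "{..<k}" "{k}"] k
    unfolding indep_var_eq by (auto simp: V sets_vimage_algebra)
  have mW: "?W J \<in> measurable (VW J) (?Pi J)" for J
    unfolding VW_def by (rule measurable_vimage_algebra1) (auto simp: space_PiM)
  have mw: "w_noise S j \<in> borel_measurable (VW J)" if "j \<in> J" for j J
    using measurable_compose[OF mW measurable_component_singleton[of j J]] that by simp
  have mE': "?E \<in> measurable VE (?Pi {..<N})"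
    unfolding VE_def by (rule measurable_vimage_algebra1) (auto simp: space_PiM)
  have mE: "eta_noise S j \<in> borel_measurable VE" if "j < N" for j
    using measurable_compose[OF mE' measurable_component_singleton[of j "{..<N}"]] that by simp
  have mX: "?X \<in> measurable VX (borel \<Otimes>\<^sub>M borel)"
    unfolding VX_def by (rule measurable_vimage_algebra1) (auto simp: space_pair_measure)
  have mX1: "x_init S \<in> borel_measurable VX" and mX2: "xh_init S \<in> borel_measurable VX"
    using measurable_compose[OF mX measurable_fst] measurable_compose[OF mX measurable_snd] by simp_all
  have mXW: "(\<lambda>\<omega>. (?X \<omega>, ?W {..<N} \<omega>)) \<in> measurable VXW ((borel \<Otimes>\<^sub>M borel) \<Otimes>\<^sub>M ?Pi {..<N})"
    unfolding VXW_def by (rule measurable_vimage_algebra1) (auto simp: space_pair_measure space_PiM)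
  have XW: "sets VX \<subseteq> sets VXW" "sets (VW {..<N}) \<subseteq> sets VXW"
    unfolding VX_def VW_def
    by (rule sets_image_in_sets;
        use measurable_compose[OF mXW measurable_fst] measurable_compose[OF mXW measurable_snd] in simp)+
  have WN: "sets (VW J) \<subseteq> sets (VW {..<N})" if "J \<subseteq> {..<N}" for J
    unfolding VW_def[of J] by (rule sets_image_in_sets) (use that in \<open>auto intro!: measurable_restrict mw\<close>)
  have wW: "sets Vw \<subseteq> sets (VW {k})"
    unfolding Vw_def by (rule sets_image_in_sets) (auto intro: mw)
  \<comment> \<open>A pi-system of triple intersections: independence of \<open>Vw\<close> is
    checked on it and then extended to the sigma-algebra it generates.\<close>
  define gens where "gens = {x \<inter> h \<inter> e |x h e. x \<in> sets VX \<and> h \<in> sets (VW {..<k}) \<and> e \<in> sets VE}"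
  \<comment> \<open>The two nested independence clauses give a three-fold product: one splits off
    \<open>e\<close> from \<open>x \<inter> h\<close>, the other splits \<open>x\<close> from
    \<open>h\<close>.\<close>
  have p1: "prob (x \<inter> h \<inter> e) = prob x * prob h * prob e"
    if "x \<in> sets VX" "h \<in> sets (VW {..<N})" "e \<in> sets VE" for x h e
  proof -
    have "x \<inter> h \<in> sets VXW" using that XW by auto
    then show ?thesis using indep_setD[OF iE _ that(3)] indep_setD[OF iX that(1,2)] by simp
  qed
  have kN: "sets (VW {..<k}) \<subseteq> sets (VW {..<N})" "sets (VW {k}) \<subseteq> sets (VW {..<N})"
    using k by (auto intro!: WN)
  have ev: "gens \<subseteq> events" "sets Vw \<subseteq> events"
  proof -
    have "sets VX \<subseteq> events" "sets (VW {..<N}) \<subseteq> events" "sets VE \<subseteq> events"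
      using indep_setD_ev1[OF iX] indep_setD_ev2[OF iX] indep_setD_ev2[OF iE] by auto
    then show "gens \<subseteq> events" "sets Vw \<subseteq> events"
      using kN wW by (auto simp: gens_def intro!: sets.Int)
  qed
  have "indep_set gens (sets Vw)"
  proof (rule indep_setI[OF ev])
    fix g w assume "g \<in> gens" and w: "w \<in> sets Vw"
    then obtain x h e where g: "g = x \<inter> h \<inter> e" and x: "x \<in> sets VX"
      and h: "h \<in> sets (VW {..<k})" and e: "e \<in> sets VE"
      by (auto simp: gens_def)
    have hN: "h \<in> sets (VW {..<N})" and wN: "w \<in> sets (VW {..<N})" and w': "w \<in> sets (VW {k})"
      using h w kN wW by auto
    \<comment> \<open>The event \<open>w\<close> is grouped with the past noise \<open>h\<close>,
      since both are process-noise events; after the three-fold product, whiteness splits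
      \<open>h \<inter> w\<close>.\<close>
    have "prob (g \<inter> w) = prob (x \<inter> (h \<inter> w) \<inter> e)"
      unfolding g by (rule arg_cong[where f = prob]) auto
    also have "\<dots> = prob x * prob (h \<inter> w) * prob e"
      using hN wN by (intro p1 x e) auto
    also have "\<dots> = prob g * prob w"
      unfolding g p1[OF x hN e] indep_setD[OF iw h w'] by simp
    finally show "prob (g \<inter> w) = prob g * prob w" .
  qed
  moreover have "Int_stable gens"
  proof (rule Int_stableI)
    fix a b assume "a \<in> gens" "b \<in> gens"
    then obtain x h e x' h' e' where "a = x \<inter> h \<inter> e" "b = x' \<inter> h' \<inter> e'"
      "x \<in> sets VX" "h \<in> sets (VW {..<k})" "e \<in> sets VE"
      "x' \<in> sets VX" "h' \<in> sets (VW {..<k})" "e' \<in> sets VE"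
      unfolding gens_def by blast
    moreover from this have "a \<inter> b = (x \<inter> x') \<inter> (h \<inter> h') \<inter> (e \<inter> e')" by auto
    ultimately show "a \<inter> b \<in> gens" unfolding gens_def by blast
  qed
  moreover have "Int_stable (sets Vw)" by (rule sets.Int_stable)
  ultimately have "indep_set (sigma_sets (space M) gens) (sigma_sets (space M) (sets Vw))"
    by (rule indep_set_sigma_sets)
  moreover have "sets (free_filt S k) \<subseteq> sigma_sets (space M) gens"
  proof -
    define G where "G = sigma (space M) gens"
    have pow: "gens \<subseteq> Pow (space M)" using ev sets.sets_into_space by blast
    have [simp]: "space G = space M" and sG: "sets G = sigma_sets (space M) gens"
      using pow by (auto simp: G_def)
    \<comment> \<open>Filling two of the three slots with the whole space places each of the three
      sigma-algebras inside \<open>gens\<close>.\<close>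
    have top: "space M \<in> sets VX" "space M \<in> sets (VW {..<k})" "space M \<in> sets VE"
      using sets.top[of VX] sets.top[of "VW {..<k}"] sets.top[of VE] by simp_all
    have "sets VX \<subseteq> gens"
    proof
      fix x assume x: "x \<in> sets VX"
      then have "x = x \<inter> space M \<inter> space M" using sets.sets_into_space[OF x] by auto
      then show "x \<in> gens" unfolding gens_def using x top by blast
    qed
    moreover have "sets (VW {..<k}) \<subseteq> gens"
    proof
      fix x assume x: "x \<in> sets (VW {..<k})"
      then have "x = space M \<inter> x \<inter> space M" using sets.sets_into_space[OF x] by auto
      then show "x \<in> gens" unfolding gens_def using x top by blast
    qed
    moreover have "sets VE \<subseteq> gens"
    proof
      fix x assume x: "x \<in> sets VE"
      then have "x = space M \<inter> space M \<inter> x" using sets.sets_into_space[OF x] by auto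
      then show "x \<in> gens" unfolding gens_def using x top by blast
    qed
    ultimately have sub: "sets VX \<subseteq> sets G" "sets (VW {..<k}) \<subseteq> sets G" "sets VE \<subseteq> sets G"
      unfolding sG by auto
    \<comment> \<open>Up to time \<open>k\<close> the free state involves only process noise with
      index below \<open>k\<close>, so \<open>VW {..<k}\<close> is enough.\<close>
    have st: "free_state S j \<in> borel_measurable G" if "j \<le> k" for j
      using that
    proof (induction j)
      case 0
      then show ?case
        using borel_measurable_mono[OF mX1 sub(1)] by (simp add: state.simps)
    next
      case (Suc j)
      have "w_noise S j \<in> borel_measurable G"
        using Suc.prems by (intro borel_measurable_mono[OF mw sub(2)]) auto
      then show ?case
        using Suc unfolding state.simps free_ctrl
        by (intro borel_measurable_add borel_measurable_matrix_vector) auto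
    qed
    have "sets (free_filt S k) \<subseteq> sets G"
    proof (rule filt_least)
      show "xh_init S \<in> borel_measurable G" by (rule borel_measurable_mono[OF mX2 sub(1)]) simp
      fix j assume j: "j \<le> k"
      have "eta_noise S j \<in> borel_measurable G"
        using j k by (intro borel_measurable_mono[OF mE sub(3)]) auto
      then show "free_obs S j \<in> borel_measurable G"
        unfolding obs.simps by (intro borel_measurable_add borel_measurable_matrix_vector st j)
    qed simp
    then show ?thesis by (simp add: sG)
  qed
  ultimately show ?thesis
    unfolding Vw_def[symmetric] by (rule indep_set_mono) auto
qed

lemma noise_sqint: "k < N \<Longrightarrow> sqint M (w_noise S k)"
  by (rule gaussian_sqint[OF lqgD(4)[OF lqg]]) (simp_all add: psd_def transpose_mat)

text \<open>Coordinatewise, independence factors the expectation of the product, and the noise has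
  mean zero.\<close>

lemma orth_noise:
  assumes k: "k < N"
  shows "orth M (free_filt S k) (w_noise S k)"
  unfolding orth_def
proof (intro allI impI)
  fix Z :: "'a \<Rightarrow> real^'l" assume Z: "sqint M Z" and ZF: "Z \<in> borel_measurable (free_filt S k)"
  note w = noise_sqint[OF k]
  have int: "integrable M (\<lambda>\<omega>. Z \<omega> $ i * w_noise S k \<omega> $ i)" for i
    using sqint_inner_integrable[OF sqint_vec_nth[OF Z] sqint_vec_nth[OF w], of i i] by simp
  have "expectation (\<lambda>\<omega>. Z \<omega> $ i * w_noise S k \<omega> $ i) = 0" for i
  proof -
    have Zi: "(\<lambda>\<omega>. Z \<omega> $ i) \<in> borel_measurable (free_filt S k)"
      using ZF by (rule borel_measurable_vec_nth_real)
    have Wi: "(\<lambda>\<omega>. w_noise S k \<omega> $ i) \<in> borel_measurable (vimage_algebra (space M) (w_noise S k) borel)"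
      by (intro borel_measurable_vec_nth_real measurable_vimage_algebra1) auto
    have "indep_var borel (\<lambda>\<omega>. Z \<omega> $ i) borel (\<lambda>\<omega>. w_noise S k \<omega> $ i)"
      unfolding indep_var_eq
    proof (intro conjI)
      show "indep_set (sigma_sets (space M) {(\<lambda>\<omega>. Z \<omega> $ i) -` A \<inter> space M |A. A \<in> sets borel})
        (sigma_sets (space M) {(\<lambda>\<omega>. w_noise S k \<omega> $ i) -` A \<inter> space M |A. A \<in> sets borel})"
        unfolding sets_vimage_algebra[symmetric]
        by (rule indep_set_mono[OF noise_indep_filt[OF k]]; rule sets_image_in_sets)
          (use Zi Wi in auto)
    qed (use sqint_vec_nth[OF Z, of i] sqint_vec_nth[OF w, of i] in \<open>auto simp: sqint_def\<close>)
    from indep_var_lebesgue_integral[OF this] show ?thesis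
      using sqint_integrable[OF sqint_vec_nth[OF Z]] sqint_integrable[OF sqint_vec_nth[OF w]]
        standard_gaussian_expectation[OF lqgD(4)[OF lqg k]] by simp
  qed
  then show "expectation (\<lambda>\<omega>. Z \<omega> \<bullet> w_noise S k \<omega>) = 0"
    using int by (simp add: inner_vec_def)
qed

section \<open>Square integrability of the closed-loop processes\<close>

lemma free_state_sqint: "k \<le> N \<Longrightarrow> sqint M (free_state S k)"
proof (induction k)
  case 0
  then show ?case
    using gaussian_sqint[OF lqgD(3)[OF lqg] lqgD(2)[OF lqg]] by (simp add: state.simps)
next
  case (Suc k)
  then show ?case
    unfolding state.simps free_ctrl
    by (intro sqint_add sqint_matrix_vector noise_sqint sqint_const) auto
qed

text \<open>Measurability is checked on the free observations and transferred by policy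
  independence. The bound \<open>k < N\<close> is that of the observation noise.\<close>

lemma filt_subalgebra:
  assumes k: "k < N"
  shows "subalgebra M (filt S v K k)"
proof -
  have "free_obs S j \<in> borel_measurable M" if "j \<le> k" for j
  proof -
    have "eta_noise S j \<in> borel_measurable M" "free_state S j \<in> borel_measurable M"
      using lqgD(6)[OF lqg, of j] free_state_sqint[of j] that k by (auto simp: gaussian_def sqint_def)
    then show ?thesis
      unfolding obs.simps by (intro borel_measurable_add borel_measurable_matrix_vector)
  qed
  then have "sets (free_filt S k) \<subseteq> sets M"
    by (intro filt_least lqgD(9)[OF lqg]) auto
  then show ?thesis by (simp add: subalgebra_def sets_filt_eq_free[of S v K])
qed

text \<open>Estimates and controls inherit square integrability from the states up to the same time,
  which leaves a strong induction on the state alone, as the feedback uses the whole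
  history.\<close>

lemma state_sqint: "k \<le> N \<Longrightarrow> sqint M (state S v K k)"
  and est_sqint: "k < N \<Longrightarrow> sqint M (est S v K k)"
  and ctrl_sqint: "k < N \<Longrightarrow> sqint M (ctrl S v K k)"
proof -
  have est: "sqint M (est S v K k)" if "sqint M (state S v K k)" "k < N" for k
    unfolding est.simps using that by (intro sqint_vec_cond_exp filt_subalgebra)
  have sum: "sqint M (\<lambda>\<omega>. \<Sum>i\<in>I. f i \<omega>)" if "finite I" "\<And>i. i \<in> I \<Longrightarrow> sqint M (f i)"
    for I :: "nat set" and f :: "nat \<Rightarrow> 'a \<Rightarrow> real^'m"
    using that by (induction I rule: finite_induct) (auto intro: sqint_add sqint_const)
  have ctrl: "sqint M (ctrl S v K k)" if "k < N" "\<And>i. i \<le> k \<Longrightarrow> sqint M (state S v K i)" for k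
    unfolding ctrl.simps
    using that by (intro sqint_add sqint_const sum sqint_matrix_vector sqint_diff est) auto
  have state: "sqint M (state S v K k)" if "k \<le> N" for k
    using that
  proof (induction k rule: less_induct)
    case (less k)
    show ?case
    proof (cases k)
      case 0
      then show ?thesis using free_state_sqint[of 0] by (simp add: state.simps)
    next
      case (Suc j)
      then show ?thesis
        using less unfolding Suc state.simps
        by (intro sqint_add sqint_matrix_vector noise_sqint ctrl) auto
    qed
  qed
  show "sqint M (state S v K k)" if "k \<le> N" using state that .
  show "sqint M (est S v K k)" if "k < N" using est state that by simp
  show "sqint M (ctrl S v K k)" if "k < N" using ctrl state that by simp
qed

subsection \<open>Estimate dynamics\<close>

lemma drift_sqint:
  assumes "k \<le> N"
  shows "sqint M (drift S v K k)"
  using sqint_diff[OF state_sqint[OF assms, of v K] free_state_sqint[OF assms]]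
  by (simp add: state_eq_free_state[of S v K])

text \<open>The drift at \<open>k\<close> is known from the filtration at \<open>k\<close>, so it
  passes through the conditional expectation unchanged. The estimation error is therefore the same
  for every policy.\<close>

lemma est_eq_free_est:
  assumes k: "k < N"
  shows "AE \<omega> in M. est S v K k \<omega> = free_est S k \<omega> + drift S v K k \<omega>"
proof -
  have eq: "est S v K k = vec_cond_exp M (free_filt S k) (\<lambda>\<omega>. free_state S k \<omega> + drift S v K k \<omega>)"
    unfolding est.simps filt_eq_free[of S v K] using state_eq_free_state[of S v K k] by (metis ext)
  show ?thesis
    unfolding eq unfolding est.simps
    using drift_measurable[of k k S v K]
    by (intro vec_cond_exp_add_measurable filt_subalgebra free_state_sqint drift_sqint k)
      (use k in \<open>auto simp: filt_eq_free[of S v K]\<close>)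
qed

text \<open>For \<open>k < N\<close> almost surely the error of the one-step prediction of the
  state; written through the free plant, it is independent of the policy by construction.\<close>

definition pred_error :: "nat \<Rightarrow> 'a \<Rightarrow> real^'n" where
  "pred_error k \<omega> = free_state S (Suc k) \<omega> - matA S k *v free_est S k \<omega>"

text \<open>The correction that the observation at \<open>Suc k\<close> makes to the one-step
  prediction, again written through the free plant.\<close>

definition innov :: "nat \<Rightarrow> 'a \<Rightarrow> real^'n" where
  "innov k \<omega> = free_est S (Suc k) \<omega> - matA S k *v free_est S k \<omega>"

lemma pred_error_sqint: "k < N \<Longrightarrow> sqint M (pred_error k)"
  unfolding pred_error_def[abs_def] by (intro sqint_diff sqint_matrix_vector state_sqint est_sqint) auto

lemma innov_sqint: "Suc k < N \<Longrightarrow> sqint M (innov k)"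
  unfolding innov_def[abs_def] by (intro sqint_diff sqint_matrix_vector est_sqint) auto

lemma orth_est_error:
  assumes "k < N"
  shows "orth M (free_filt S k) (\<lambda>\<omega>. free_state S k \<omega> - free_est S k \<omega>)"
  using orth_vec_cond_exp[OF filt_subalgebra[OF assms] free_state_sqint] assms
  by (simp add: est.simps)

text \<open>The prediction error is the propagated estimation error plus the new process noise, and
  both are orthogonal to the filtration at \<open>k\<close>.\<close>

lemma orth_pred_error:
  assumes k: "k < N"
  shows "orth M (free_filt S k) (pred_error k)"
proof -
  have "orth M (free_filt S k)
      (\<lambda>\<omega>. matA S k *v (free_state S k \<omega> - free_est S k \<omega>) + matG S k *v w_noise S k \<omega>)"
    using k by (intro orth_add orth_matrix_vector orth_est_error orth_noise sqint_matrix_vector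
        sqint_diff state_sqint est_sqint noise_sqint) auto
  moreover have "matA S k *v (free_state S k \<omega> - free_est S k \<omega>) + matG S k *v w_noise S k \<omega> = pred_error k \<omega>" for \<omega>
    by (simp add: pred_error_def state.simps free_ctrl matrix_vector_mult_diff_distrib)
  ultimately show ?thesis by simp
qed

text \<open>The correction is the prediction error minus the estimation error at
  \<open>Suc k\<close>; the latter is orthogonal even to the larger filtration at
  \<open>Suc k\<close>.\<close>

lemma orth_innov:
  assumes k: "Suc k < N"
  shows "orth M (free_filt S k) (innov k)"
proof -
  have "orth M (free_filt S k) (\<lambda>\<omega>. free_state S (Suc k) \<omega> - free_est S (Suc k) \<omega>)"
    by (rule orth_mono[OF orth_est_error[OF k] filt_mono]) auto
  then have "orth M (free_filt S k)
      (\<lambda>\<omega>. pred_error k \<omega> - (free_state S (Suc k) \<omega> - free_est S (Suc k) \<omega>))"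
    by - (rule orth_diff[OF orth_pred_error _ pred_error_sqint sqint_diff[OF state_sqint est_sqint]],
        use k in auto)
  moreover have "pred_error k \<omega> - (free_state S (Suc k) \<omega> - free_est S (Suc k) \<omega>) = innov k \<omega>" for \<omega>
    by (simp add: pred_error_def innov_def)
  ultimately show ?thesis by simp
qed

text \<open>With the estimate in place of the state on the right, this has the same form as the
  estimate recursion, so one computation of means and variances serves both.\<close>

lemma state_Suc:
  assumes k: "k < N"
  shows "AE \<omega> in M. state S v K (Suc k) \<omega> =
    matA S k *v est S v K k \<omega> + matB S k *v ctrl S v K k \<omega> + pred_error k \<omega>"
  using est_eq_free_est[OF k, of v K]
  by eventually_elim
    (simp add: state_eq_free_state[of S v K "Suc k"] pred_error_def matrix_vector_right_distrib)

lemma est_Suc: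
  assumes k: "Suc k < N"
  shows "AE \<omega> in M. est S v K (Suc k) \<omega> =
    matA S k *v est S v K k \<omega> + matB S k *v ctrl S v K k \<omega> + innov k \<omega>"
  using est_eq_free_est[OF k, of v K] est_eq_free_est[OF Suc_lessD[OF k], of v K]
  by eventually_elim (simp add: innov_def matrix_vector_right_distrib)

lemma est_0: "est S v K 0 = free_est S 0"
  by (simp add: est.simps state.simps filt_eq_free[of S v K])

end

subsection \<open>Linear regression on a possibly degenerate vector\<close>

context prob_space
begin

lemma cov_matrix_vector:
  assumes U: "sqint M U" and X: "sqint M X"
  shows "(cov M U X *v a) $ i =
    expectation (\<lambda>\<omega>. (U \<omega> - expectation U) $ i * ((X \<omega> - expectation X) \<bullet> a))"
proof -
  let ?u = "\<lambda>\<omega>. U \<omega> - expectation U" and ?c = "\<lambda>\<omega>. X \<omega> - expectation X"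
  have "sqint M ?u" "sqint M ?c" by (intro sqint_diff U X sqint_const)+
  then have int: "integrable M (\<lambda>\<omega>. ?u \<omega> $ i * ?c \<omega> $ j)" for j
    using sqint_inner_integrable[OF sqint_vec_nth sqint_vec_nth, of M ?u ?c i j] by simp
  have "(cov M U X *v a) $ i = (\<Sum>j\<in>UNIV. expectation (\<lambda>\<omega>. ?u \<omega> $ i * ?c \<omega> $ j) * a $ j)"
    by (simp add: matrix_vector_mult_def cov_def del: vector_minus_component)
  also have "\<dots> = expectation (\<lambda>\<omega>. \<Sum>j\<in>UNIV. ?u \<omega> $ i * ?c \<omega> $ j * a $ j)"
    by (simp add: int del: vector_minus_component)
  also have "\<dots> = expectation (\<lambda>\<omega>. ?u \<omega> $ i * (?c \<omega> \<bullet> a))"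
    by (simp add: inner_vec_def sum_distrib_left mult.assoc del: vector_minus_component)
  finally show ?thesis .
qed

text \<open>Directions in the kernel of \<open>Cov(X)\<close> carry no randomness, so they are annihilated by \<open>Cov(U, X)\<close>.\<close>

lemma cov_pinv:
  assumes U: "sqint M U" and X: "sqint M X"
  shows "cov M U X ** pinv (cov M X X) ** cov M X X = cov M U X"
proof -
  let ?P = "cov M X X"
  let ?c = "\<lambda>\<omega>. X \<omega> - expectation X"
  have c: "sqint M ?c" by (intro sqint_diff X sqint_const)
  have pinv: "?P ** pinv ?P ** ?P = ?P"
    using is_pinv_pinv_symmetric[OF transpose_cov] by (auto simp: is_pinv_def)
  have "(cov M U X ** pinv ?P ** ?P) *v b = cov M U X *v b" for b
  proof -
    \<comment> \<open>The part of \<open>b\<close> removed by the projection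
      \<open>pinv ?P ** ?P\<close>; the first Penrose equation puts it in the kernel of
      \<open>?P\<close>.\<close>
    define a where "a = b - (pinv ?P ** ?P) *v b"
    have "?P *v a = 0"
      using pinv by (simp add: a_def matrix_vector_mult_diff_distrib matrix_vector_mul_assoc matrix_mul_assoc)
    have int: "integrable M (\<lambda>\<omega>. (?c \<omega> \<bullet> a)\<^sup>2)"
      using sqint_bounded_linear[OF bounded_linear_inner_left c, of a]
      by (simp add: sqint_def power2_eq_square)
    have "expectation (\<lambda>\<omega>. (?c \<omega> \<bullet> a)\<^sup>2) = 0"
    proof -
      have sum: "(\<Sum>i\<in>UNIV. a $ i * (?c \<omega> $ i * (?c \<omega> \<bullet> a))) = (?c \<omega> \<bullet> a)\<^sup>2" for \<omega>
        by (simp add: inner_vec_def power2_eq_square sum_distrib_right mult_ac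
            del: vector_minus_component)
      have i: "integrable M (\<lambda>\<omega>. ?c \<omega> $ i * (?c \<omega> \<bullet> a))" for i
        using sqint_inner_integrable[OF sqint_vec_nth[OF c]
            sqint_bounded_linear[OF bounded_linear_inner_left c], of i a] by simp
      have "0 = a \<bullet> (?P *v a)" by (simp add: \<open>?P *v a = 0\<close>)
      also have "\<dots> = (\<Sum>i\<in>UNIV. a $ i * expectation (\<lambda>\<omega>. ?c \<omega> $ i * (?c \<omega> \<bullet> a)))"
        unfolding inner_vec_def[of a "?P *v a"] by (simp only: cov_matrix_vector[OF X X] inner_real_def)
      also have "\<dots> = expectation (\<lambda>\<omega>. \<Sum>i\<in>UNIV. a $ i * (?c \<omega> $ i * (?c \<omega> \<bullet> a)))"
        by (simp add: i del: vector_minus_component)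
      finally show ?thesis unfolding sum by simp
    qed
    then have "AE \<omega> in M. (?c \<omega> \<bullet> a)\<^sup>2 = 0"
      using integral_nonneg_eq_0_iff_AE[OF int] by simp
    then have "expectation (\<lambda>\<omega>. (U \<omega> - expectation U) $ i * (?c \<omega> \<bullet> a)) = 0" for i
      by (intro integral_eq_zero_AE) (auto elim!: eventually_mono)
    then have "cov M U X *v a = 0"
      by (simp add: vec_eq_iff cov_matrix_vector[OF U X] del: vector_minus_component)
    then show ?thesis
      by (simp add: a_def matrix_vector_mult_diff_distrib matrix_vector_mul_assoc matrix_mul_assoc)
  qed
  then show ?thesis by (simp add: matrix_eq)
qed

text \<open>These are the normal equations: \<open>H ** cov M X X = cov M U X\<close> holds even for
  singular \<open>cov M X X\<close> by \<open>cov_pinv\<close>, and the general \<open>L\<close>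
  follows by expanding into coordinates.\<close>

lemma regression_residual_uncorrelated:
  fixes U :: "'a \<Rightarrow> real^'m" and X :: "'a \<Rightarrow> real^'n" and L :: "real^'n^'m"
  assumes U: "sqint M U" and X: "sqint M X"
    and H: "H = cov M U X ** pinv (cov M X X)"
  shows "expectation (\<lambda>\<omega>. (L *v (X \<omega> - expectation X)) \<bullet>
    (U \<omega> - expectation U - H *v (X \<omega> - expectation X))) = 0"
proof -
  define u where "u \<omega> = U \<omega> - expectation U" for \<omega>
  define c where "c \<omega> = X \<omega> - expectation X" for \<omega>
  have u: "sqint M u" and c: "sqint M c"
    unfolding u_def[abs_def] c_def[abs_def] by (intro sqint_diff U X sqint_const)+
  have iu: "integrable M (\<lambda>\<omega>. c \<omega> $ j * u \<omega> $ i)" for i j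
    using sqint_inner_integrable[OF sqint_vec_nth[OF c] sqint_vec_nth[OF u], of j i] by simp
  have ic: "integrable M (\<lambda>\<omega>. c \<omega> $ j * c \<omega> $ i)" for i j
    using sqint_inner_integrable[OF sqint_vec_nth[OF c] sqint_vec_nth[OF c], of j i] by simp
  have ih: "integrable M (\<lambda>\<omega>. c \<omega> $ j * (H *v c \<omega>) $ i)" for i j
    using sqint_inner_integrable[OF sqint_vec_nth[OF c] sqint_vec_nth[OF sqint_matrix_vector[OF c]], of j H i]
    by simp
  have z: "expectation (\<lambda>\<omega>. c \<omega> $ j * (u \<omega> $ i - (H *v c \<omega>) $ i)) = 0" for i j
  proof -
    have "expectation (\<lambda>\<omega>. c \<omega> $ j * (H *v c \<omega>) $ i) =
        expectation (\<lambda>\<omega>. \<Sum>l\<in>UNIV. H $ i $ l * (c \<omega> $ l * c \<omega> $ j))"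
      by (simp add: matrix_vector_mult_def sum_distrib_left mult_ac)
    also have "\<dots> = (\<Sum>l\<in>UNIV. H $ i $ l * expectation (\<lambda>\<omega>. c \<omega> $ l * c \<omega> $ j))"
      using ic by simp
    also have "\<dots> = (H ** cov M X X) $ i $ j"
      by (simp add: matrix_matrix_mult_def cov_def c_def)
    also have "\<dots> = cov M U X $ i $ j"
      using cov_pinv[OF U X] by (simp add: H)
    also have "\<dots> = expectation (\<lambda>\<omega>. c \<omega> $ j * u \<omega> $ i)"
      by (simp add: cov_def c_def u_def mult.commute)
    finally show ?thesis
      using iu ih by (simp add: right_diff_distrib)
  qed
  have iz: "integrable M (\<lambda>\<omega>. c \<omega> $ j * (u \<omega> $ i - (H *v c \<omega>) $ i))" for i j
    using iu ih by (simp add: right_diff_distrib)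
  have "expectation (\<lambda>\<omega>. (L *v c \<omega>) \<bullet> (u \<omega> - H *v c \<omega>)) =
      expectation (\<lambda>\<omega>. \<Sum>i\<in>UNIV. \<Sum>j\<in>UNIV. L $ i $ j * (c \<omega> $ j * (u \<omega> $ i - (H *v c \<omega>) $ i)))"
    by (rule Bochner_Integration.integral_cong)
      (simp_all add: inner_vec_def matrix_vector_mult_def[of L] sum_distrib_left mult_ac)
  also have "\<dots> = 0"
    using iz z by simp
  finally show ?thesis by (simp add: u_def c_def)
qed

end

subsection \<open>Comparison with the current-estimate policy\<close>

context lqg_plant
begin

text \<open>The feedback acts on centred estimates, so the gains have no influence on the
  means.\<close>

lemma ctrl_mean:
  assumes k: "k < N"
  shows "expectation (ctrl S v K k) = v k"
proof -
  have i: "integrable M (est S v K i)" if "i \<le> k" for i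
    using est_sqint that k by (intro sqint_integrable) auto
  have j: "integrable M (\<lambda>\<omega>. K k i *v (est S v K i \<omega> - expectation (est S v K i)))" if "i \<le> k" for i
    using est_sqint that k by (intro sqint_integrable sqint_matrix_vector sqint_diff sqint_const) auto
  have z: "expectation (\<lambda>\<omega>. K k i *v (est S v K i \<omega> - expectation (est S v K i))) = 0" if "i \<le> k" for i
    using i[OF that] by (simp add: integral_matrix_vector prob_space)
  let ?s = "\<lambda>\<omega>. \<Sum>i\<le>k. K k i *v (est S v K i \<omega> - expectation (est S v K i))"
  have "integrable M ?s" by (rule Bochner_Integration.integrable_sum) (use j in simp)
  moreover have "expectation ?s = 0"
    using j z by (subst Bochner_Integration.integral_sum) auto
  ultimately show ?thesis
    unfolding ctrl.simps by (subst Bochner_Integration.integral_add) (simp_all add: prob_space)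
qed

text \<open>The pair \<open>X\<close>, \<open>W\<close> stands for the next estimate with
  \<open>innov\<close> or the next state with \<open>pred_error\<close>.\<close>

lemma next_mean:
  assumes k: "k < N" and X: "sqint M X" and W: "sqint M W" and orth: "orth M (free_filt S k) W"
    and eq: "AE \<omega> in M. X \<omega> = matA S k *v est S v K k \<omega> + matB S k *v ctrl S v K k \<omega> + W \<omega>"
  shows "expectation X = matA S k *v expectation (est S v K k) + matB S k *v v k"
proof -
  note s = est_sqint[OF k, of v K] ctrl_sqint[OF k, of v K]
  note i = sqint_integrable[OF s(1)] sqint_integrable[OF s(2)] sqint_integrable[OF W]
    sqint_integrable[OF sqint_matrix_vector[OF s(1), of "matA S k"]]
    sqint_integrable[OF sqint_matrix_vector[OF s(2), of "matB S k"]]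
  have "expectation X =
      expectation (\<lambda>\<omega>. matA S k *v est S v K k \<omega> + matB S k *v ctrl S v K k \<omega> + W \<omega>)"
    using eq sqint_integrable[OF X] i by (intro integral_cong_AE) auto
  then show ?thesis
    using i orth_integral_eq_0[OF orth W] by (simp add: integral_matrix_vector ctrl_mean[OF k])
qed

lemma est_mean_eq: "k < N \<Longrightarrow> expectation (est S v K k) = expectation (est S v K' k)"
proof (induction k)
  case 0
  then show ?case by (simp add: est_0[of v K] est_0[of v K'])
next
  case (Suc k)
  then show ?case
    using next_mean[OF _ _ innov_sqint orth_innov est_Suc, of k v K]
      next_mean[OF _ _ innov_sqint orth_innov est_Suc, of k v K'] by (simp add: est_sqint)
qed

lemma state_mean_eq: "k \<le> N \<Longrightarrow> expectation (state S v K k) = expectation (state S v K' k)"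
proof (cases k)
  case 0
  then show ?thesis by (simp add: state.simps)
next
  case (Suc j)
  assume "k \<le> N"
  then show ?thesis
    using Suc next_mean[OF _ _ pred_error_sqint orth_pred_error state_Suc, of j v K]
      next_mean[OF _ _ pred_error_sqint orth_pred_error state_Suc, of j v K'] est_mean_eq[of j v K K']
    by (simp add: state_sqint)
qed

text \<open>The gain \<open>H\<close> is left free so that the same formulas cover the given policy
  and the comparison policy, whose residual is zero.\<close>

definition resid :: "(nat \<Rightarrow> real^'m) \<Rightarrow> (nat \<Rightarrow> nat \<Rightarrow> real^'n^'m) \<Rightarrow> real^'n^'m \<Rightarrow> nat \<Rightarrow> 'a \<Rightarrow> real^'m" where
  "resid v K H k \<omega> = ctrl S v K k \<omega> - v k - H *v (est S v K k \<omega> - expectation (est S v K k))"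

text \<open>Quantifying over \<open>L\<close> expresses that every entry of the cross-covariance of
  estimate and residual vanishes.\<close>

definition uncorr :: "(nat \<Rightarrow> real^'m) \<Rightarrow> (nat \<Rightarrow> nat \<Rightarrow> real^'n^'m) \<Rightarrow> real^'n^'m \<Rightarrow> nat \<Rightarrow> bool" where
  "uncorr v K H k \<longleftrightarrow> (\<forall>L :: real^'n^'m.
     expectation (\<lambda>\<omega>. (L *v (est S v K k \<omega> - expectation (est S v K k))) \<bullet> resid v K H k \<omega>) = 0)"

lemma resid_sqint: "k < N \<Longrightarrow> sqint M (resid v K H k)"
  unfolding resid_def[abs_def]
  by (intro sqint_diff sqint_const sqint_matrix_vector ctrl_sqint est_sqint)

lemma uncorrD:
  fixes D :: "real^'m^'d" and L :: "real^'n^'d"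
  assumes "uncorr v K H k"
  shows "expectation (\<lambda>\<omega>. (L *v (est S v K k \<omega> - expectation (est S v K k))) \<bullet> (D *v resid v K H k \<omega>)) = 0"
proof -
  have "(L *v x) \<bullet> (D *v y) = ((transpose D ** L) *v x) \<bullet> y" for x y
    by (simp add: inner_matrix_vector_transpose matrix_vector_mul_assoc del: transpose_matrix_vector)
  then show ?thesis using assms by (simp add: uncorr_def)
qed

lemma resid_measurable: "resid v K H k \<in> borel_measurable (free_filt S k)"
  unfolding resid_def[abs_def] filt_eq_free[of S v K k, symmetric]
  by (intro borel_measurable_diff borel_measurable_matrix_vector ctrl_measurable est_measurable) auto

lemma var_qform_ctrl:
  assumes k: "k < N" and Q: "psd Q" and unc: "uncorr v K H k"
  shows "var_qform M Q (ctrl S v K k) =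
    var_qform M (transpose H ** Q ** H) (est S v K k) + expectation (\<lambda>\<omega>. qform Q (resid v K H k \<omega>))"
proof -
  let ?c = "\<lambda>\<omega>. est S v K k \<omega> - expectation (est S v K k)"
  have "ctrl S v K k \<omega> - v k = H *v ?c \<omega> + resid v K H k \<omega>" for \<omega> by (simp add: resid_def)
  then have "var_qform M Q (ctrl S v K k) = expectation (\<lambda>\<omega>. qform Q (H *v ?c \<omega> + resid v K H k \<omega>))"
    by (simp add: var_qform_def ctrl_mean[OF k])
  also have "\<dots> = expectation (\<lambda>\<omega>. qform Q (H *v ?c \<omega>)) + expectation (\<lambda>\<omega>. qform Q (resid v K H k \<omega>))"
    using Q by (intro integral_qform_add uncorrD unc sqint_matrix_vector sqint_diff sqint_const est_sqint resid_sqint k)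
      (auto simp: psd_def)
  finally show ?thesis by (simp add: var_qform_def qform_matrix_vector)
qed

text \<open>The centred \<open>X\<close> is \<open>F\<close> applied to the centred estimate, plus
  \<open>matB S k\<close> applied to the residual, plus \<open>W\<close>. The first two are
  uncorrelated by \<open>uncorr\<close>, and \<open>W\<close> is orthogonal to both because they are
  known at time \<open>k\<close>.\<close>

lemma var_qform_next:
  assumes k: "k < N" and X: "sqint M X" and W: "sqint M W" and orth: "orth M (free_filt S k) W"
    and eq: "AE \<omega> in M. X \<omega> = matA S k *v est S v K k \<omega> + matB S k *v ctrl S v K k \<omega> + W \<omega>"
    and Q: "psd Q" and unc: "uncorr v K H k" and F: "F = matA S k + matB S k ** H"
  shows "var_qform M Q X = var_qform M (transpose F ** Q ** F) (est S v K k) +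
    expectation (\<lambda>\<omega>. qform Q (matB S k *v resid v K H k \<omega>)) + expectation (\<lambda>\<omega>. qform Q (W \<omega>))"
proof -
  let ?c = "\<lambda>\<omega>. est S v K k \<omega> - expectation (est S v K k)"
  let ?r = "\<lambda>\<omega>. matB S k *v resid v K H k \<omega>"
  have Qt: "transpose Q = Q" using Q by (simp add: psd_def)
  have Fc: "sqint M (\<lambda>\<omega>. F *v ?c \<omega>)" and r: "sqint M ?r"
    by (intro sqint_matrix_vector sqint_diff sqint_const est_sqint resid_sqint k)+
  have m: "(\<lambda>\<omega>. F *v ?c \<omega> + ?r \<omega>) \<in> borel_measurable (free_filt S k)"
    using est_measurable[of k k S v K] unfolding filt_eq_free[of S v K]
    by (intro borel_measurable_add borel_measurable_matrix_vector resid_measurable borel_measurable_diff) auto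
  have "AE \<omega> in M. X \<omega> - expectation X = F *v ?c \<omega> + ?r \<omega> + W \<omega>"
    using eq unfolding next_mean[OF k X W orth eq]
    by eventually_elim
      (simp add: resid_def F matrix_vector_mult_add_rdistrib matrix_vector_mult_diff_distrib
        flip: matrix_vector_mul_assoc)
  then have "var_qform M Q X = expectation (\<lambda>\<omega>. qform Q (F *v ?c \<omega> + ?r \<omega> + W \<omega>))"
    unfolding var_qform_def
    by (intro integral_cong_AE borel_measurable_integrable integrable_qform sqint_diff sqint_add X W Fc r sqint_const)
      (auto elim!: eventually_mono)
  also have "\<dots> = expectation (\<lambda>\<omega>. qform Q (F *v ?c \<omega> + ?r \<omega>)) + expectation (\<lambda>\<omega>. qform Q (W \<omega>))"
    by (intro integral_qform_add_orth[OF _ m] sqint_add Fc r W orth Qt)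
  also have "expectation (\<lambda>\<omega>. qform Q (F *v ?c \<omega> + ?r \<omega>)) =
      expectation (\<lambda>\<omega>. qform Q (F *v ?c \<omega>)) + expectation (\<lambda>\<omega>. qform Q (?r \<omega>))"
    using uncorrD[OF unc, of F "Q ** matB S k"]
    by (intro integral_qform_add Fc r Qt) (simp flip: matrix_vector_mul_assoc)
  finally show ?thesis by (simp add: var_qform_def qform_matrix_vector)
qed

text \<open>The history-affine encoding of the current-estimate-affine policy with gains \<open>H\<close>.\<close>

definition diag_gain :: "(nat \<Rightarrow> real^'n^'m) \<Rightarrow> nat \<Rightarrow> nat \<Rightarrow> real^'n^'m" where
  "diag_gain H k i = (if i = k then H k else 0)"

lemma resid_diag_gain: "resid v (diag_gain H) (H k) k \<omega> = 0"
proof -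
  have "(\<Sum>i\<le>k. diag_gain H k i *v f i) = H k *v f k" for f
    by (subst sum.remove[of _ k]) (auto simp: diag_gain_def intro!: sum.neutral)
  then show ?thesis by (simp add: resid_def ctrl.simps)
qed

lemma uncorr_diag_gain: "uncorr v (diag_gain H) (H k) k"
  by (simp add: uncorr_def resid_diag_gain)

text \<open>Both policies share the closed-loop matrix \<open>?F\<close> and the noise term, and the
  comparison policy has no residual term. The weight is generalised because each step replaces
  \<open>Q\<close> by its congruence with \<open>?F\<close>.\<close>

lemma var_est_le:
  assumes unc: "\<And>k. k < N \<Longrightarrow> uncorr v K (H k) k" and "k < N" and "psd Q"
  shows "var_qform M Q (est S v (diag_gain H) k) \<le> var_qform M Q (est S v K k)"
  using assms(2,3)
proof (induction k arbitrary: Q)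
  case 0
  then show ?case by (simp add: est_0[of v K] est_0[of v "diag_gain H"])
next
  case (Suc k)
  let ?F = "matA S k + matB S k ** H k"
  have k: "k < N" using Suc by simp
  note n = var_qform_next[OF k est_sqint[OF Suc.prems(1)] innov_sqint[OF Suc.prems(1)]
      orth_innov[OF Suc.prems(1)] est_Suc[OF Suc.prems(1)] Suc.prems(2) _ refl]
  have "0 \<le> expectation (\<lambda>\<omega>. qform Q (matB S k *v resid v K (H k) k \<omega>))"
    by (intro integral_nonneg_AE AE_I2 psd_qform_nonneg Suc.prems)
  then show ?case
    using n[OF unc[OF k]] n[OF uncorr_diag_gain[of v H k]] Suc.IH[OF k psd_congruence[OF Suc.prems(2)], of ?F]
    by (simp add: resid_diag_gain qform_def)
qed

text \<open>The state at \<open>Suc j\<close> is driven by the estimate at \<open>j\<close>, so the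
  comparison of estimates gives the result in one step.\<close>

lemma var_state_le:
  assumes unc: "\<And>k. k < N \<Longrightarrow> uncorr v K (H k) k" and "k \<le> N" and Q: "psd Q"
  shows "var_qform M Q (state S v (diag_gain H) k) \<le> var_qform M Q (state S v K k)"
proof (cases k)
  case 0
  then show ?thesis by (simp add: state.simps)
next
  case (Suc j)
  let ?F = "matA S j + matB S j ** H j"
  have j: "j < N" and kN: "Suc j \<le> N" using Suc assms(2) by auto
  note n = var_qform_next[OF j state_sqint[OF kN] pred_error_sqint[OF j] orth_pred_error[OF j]
      state_Suc[OF j] Q _ refl]
  have "0 \<le> expectation (\<lambda>\<omega>. qform Q (matB S j *v resid v K (H j) j \<omega>))"
    by (intro integral_nonneg_AE AE_I2 psd_qform_nonneg Q)
  then show ?thesis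
    unfolding Suc
    using n[OF unc[OF j]] n[OF uncorr_diag_gain[of v H j]] var_est_le[OF unc j psd_congruence[OF Q], of ?F]
    by (simp add: resid_diag_gain qform_def)
qed

text \<open>The residual term is kept on the left: it is the strict saving that later contradicts
  optimality unless it vanishes.\<close>

lemma var_ctrl_le:
  assumes unc: "\<And>k. k < N \<Longrightarrow> uncorr v K (H k) k" and k: "k < N" and Q: "psd Q"
  shows "var_qform M Q (ctrl S v (diag_gain H) k) + expectation (\<lambda>\<omega>. qform Q (resid v K (H k) k \<omega>))
    \<le> var_qform M Q (ctrl S v K k)"
  using var_qform_ctrl[OF k Q unc[OF k]] var_qform_ctrl[OF k Q uncorr_diag_gain[of v H k]]
    var_est_le[OF unc k psd_congruence[OF Q], of "H k"]
  by (simp add: resid_diag_gain qform_def)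

lemma uncorr_gainH:
  assumes k: "k < N"
  shows "uncorr v K (gainH S v K k) k"
  using regression_residual_uncorrelated[OF ctrl_sqint[OF k] est_sqint[OF k] gainH_def]
  by (simp add: uncorr_def resid_def ctrl_mean[OF k])

lemma feasible_diag_gain:
  assumes unc: "\<And>k. k < N \<Longrightarrow> uncorr v K (H k) k"
    and gx: "cov_monotonic gx" and gu: "cov_monotonic gu" and feas: "feasible S N gx gu v K"
  shows "feasible S N gx gu v (diag_gain H)"
  unfolding feasible_def
proof (intro conjI ballI allI impI)
  fix k assume "k \<in> {1..N}"
  then have k: "k \<le> N" and le: "gx (expectation (state S v K k)) (cov M (state S v K k) (state S v K k)) \<le> 0"
    using feas by (auto simp: feasible_def)
  have "cov M (state S v (diag_gain H) k) (state S v (diag_gain H) k) \<preceq>\<^sub>L cov M (state S v K k) (state S v K k)"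
    by (intro loewner_le_cov state_sqint k var_state_le unc)
  with gx have "gx (expectation (state S v K k)) (cov M (state S v (diag_gain H) k) (state S v (diag_gain H) k))
      \<le> gx (expectation (state S v K k)) (cov M (state S v K k) (state S v K k))"
    by (simp add: cov_monotonic_def psd_cov state_sqint k)
  with le show "gx (expectation (state S v (diag_gain H) k))
      (cov M (state S v (diag_gain H) k) (state S v (diag_gain H) k)) \<le> 0"
    by (simp add: state_mean_eq[OF k, of v "diag_gain H" K])
next
  fix k assume k: "k < N"
  then have le: "gu (v k) (cov M (ctrl S v K k) (ctrl S v K k)) \<le> 0"
    using feas by (auto simp: feasible_def ctrl_mean)
  have "var_qform M Q (ctrl S v (diag_gain H) k) \<le> var_qform M Q (ctrl S v K k)" if "psd Q" for Q
  proof -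
    have "0 \<le> expectation (\<lambda>\<omega>. qform Q (resid v K (H k) k \<omega>))"
      by (intro integral_nonneg_AE AE_I2 psd_qform_nonneg that)
    then show ?thesis using var_ctrl_le[OF unc k that] by simp
  qed
  then have "cov M (ctrl S v (diag_gain H) k) (ctrl S v (diag_gain H) k) \<preceq>\<^sub>L cov M (ctrl S v K k) (ctrl S v K k)"
    by (intro loewner_le_cov ctrl_sqint k)
  with gu have "gu (v k) (cov M (ctrl S v (diag_gain H) k) (ctrl S v (diag_gain H) k))
      \<le> gu (v k) (cov M (ctrl S v K k) (ctrl S v K k))"
    by (simp add: cov_monotonic_def psd_cov ctrl_sqint k)
  with le show "gu (expectation (ctrl S v (diag_gain H) k))
      (cov M (ctrl S v (diag_gain H) k) (ctrl S v (diag_gain H) k)) \<le> 0"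
    by (simp add: ctrl_mean[OF k])
qed

text \<open>After centring, the mean parts of the two costs agree; states only improve, and each
  control term saves at least its residual.\<close>

lemma cost_diag_gain:
  assumes unc: "\<And>k. k < N \<Longrightarrow> uncorr v K (H k) k"
    and Q: "\<And>k. k \<le> N \<Longrightarrow> psd (Q k)" and R: "\<And>k. k < N \<Longrightarrow> psd (R k)"
  shows "cost S N Q R v (diag_gain H) + (\<Sum>k<N. expectation (\<lambda>\<omega>. qform (R k) (resid v K (H k) k \<omega>)))
    \<le> cost S N Q R v K"
proof -
  have Qt: "transpose (Q k) = Q k" if "k \<le> N" for k using Q[OF that] by (simp add: psd_def)
  have Rt: "transpose (R k) = R k" if "k < N" for k using R[OF that] by (simp add: psd_def)
  have "(\<Sum>k\<le>N. expectation (\<lambda>\<omega>. qform (Q k) (state S v (diag_gain H) k \<omega>)))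
      \<le> (\<Sum>k\<le>N. expectation (\<lambda>\<omega>. qform (Q k) (state S v K k \<omega>)))"
  proof (rule sum_mono)
    fix k assume "k \<in> {..N}"
    then have k: "k \<le> N" by simp
    show "expectation (\<lambda>\<omega>. qform (Q k) (state S v (diag_gain H) k \<omega>))
        \<le> expectation (\<lambda>\<omega>. qform (Q k) (state S v K k \<omega>))"
      using var_state_le[OF unc k Q[OF k]] state_mean_eq[OF k, of v "diag_gain H" K]
      by (simp add: integral_qform_centre[OF state_sqint[OF k] Qt[OF k]])
  qed
  moreover have "(\<Sum>k<N. expectation (\<lambda>\<omega>. qform (R k) (ctrl S v (diag_gain H) k \<omega>)) +
        expectation (\<lambda>\<omega>. qform (R k) (resid v K (H k) k \<omega>)))
      \<le> (\<Sum>k<N. expectation (\<lambda>\<omega>. qform (R k) (ctrl S v K k \<omega>)))"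
  proof (rule sum_mono)
    fix k assume "k \<in> {..<N}"
    then have k: "k < N" by simp
    show "expectation (\<lambda>\<omega>. qform (R k) (ctrl S v (diag_gain H) k \<omega>)) +
        expectation (\<lambda>\<omega>. qform (R k) (resid v K (H k) k \<omega>))
        \<le> expectation (\<lambda>\<omega>. qform (R k) (ctrl S v K k \<omega>))"
      using var_ctrl_le[OF unc k R[OF k]]
      by (simp add: integral_qform_centre[OF ctrl_sqint[OF k] Rt[OF k]] ctrl_mean[OF k])
  qed
  ultimately show ?thesis
    by (simp add: cost_def qform_def sum.distrib)
qed

end

section \<open>Vanishing of the regression residual at an optimum\<close>

theorem theorem3:
  fixes S :: "('a,'n::finite,'m::finite,'l::finite,'p::finite,'q::finite) plant"
    and N :: nat
    and \<mu>0 :: "real^'n" and P0 :: "real^'n^'n"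
    and Q :: "nat \<Rightarrow> real^'n^'n" and R :: "nat \<Rightarrow> real^'m^'m"
    and gx :: "real^'n \<Rightarrow> real^'n^'n \<Rightarrow> real" and gu :: "real^'m \<Rightarrow> real^'m^'m \<Rightarrow> real"
    and v :: "nat \<Rightarrow> real^'m" and K :: "nat \<Rightarrow> nat \<Rightarrow> real^'n^'m"
  assumes "lqg S N \<mu>0 P0"
    and "\<And>k. k \<le> N \<Longrightarrow> psd (Q k)"
    and "\<And>k. k < N \<Longrightarrow> posdef (R k)"
    and "cov_monotonic gx" and "cov_monotonic gu"
    and "optimal S N Q R gx gu v K"
  shows "\<forall>k<N. AE \<omega> in prob_sp S. ctrl S v K k \<omega> = policyM S v K k (est S v K k \<omega>)"
proof (intro allI impI)
  fix k assume k: "k < N"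
  interpret lqg_plant S N \<mu>0 P0 by unfold_locales (rule assms(1))
  let ?H = "gainH S v K"
  let ?e = "\<lambda>k. resid v K (?H k) k"
  let ?E = "\<lambda>k. expectation (\<lambda>\<omega>. qform (R k) (?e k \<omega>))"
  have R: "psd (R k)" if "k < N" for k
  proof -
    have "0 \<le> x \<bullet> (R k *v x)" for x
      using assms(3)[OF that] by (cases "x = 0") (auto simp: posdef_def intro: less_imp_le)
    then show ?thesis using assms(3)[OF that] by (simp add: psd_def posdef_def)
  qed
  have nonneg: "0 \<le> ?E k" if "k < N" for k
    by (intro integral_nonneg_AE AE_I2 psd_qform_nonneg R that)
  have "feasible S N gx gu v (diag_gain ?H)"
    using assms(4-6) uncorr_gainH by (intro feasible_diag_gain) (auto simp: optimal_def)
  \<comment> \<open>The comparison policy competes because it is encoded as a history-affine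
    policy.\<close>
  then have "cost S N Q R v K \<le> cost S N Q R v (diag_gain ?H)"
    using assms(6) by (simp add: optimal_def)
  with cost_diag_gain[of v K ?H Q R, OF uncorr_gainH assms(2) R] have "(\<Sum>k<N. ?E k) \<le> 0" by simp
  moreover have "?E k \<le> (\<Sum>k<N. ?E k)"
    using k nonneg by (intro member_le_sum) auto
  ultimately have "?E k = 0" using nonneg[OF k] by simp
  then have "AE \<omega> in M. qform (R k) (?e k \<omega>) = 0"
    using integral_nonneg_eq_0_iff_AE[OF integrable_qform[OF resid_sqint[OF k]], of "R k" v K "?H k"]
      psd_qform_nonneg[OF R[OF k]] by simp
  then show "AE \<omega> in M. ctrl S v K k \<omega> = policyM S v K k (est S v K k \<omega>)"
  proof eventually_elim
    fix \<omega> assume "qform (R k) (?e k \<omega>) = 0"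
    \<comment> \<open>Strict definiteness of \<open>R k\<close> turns a vanishing quadratic form
      into a vanishing residual.\<close>
    then have "?e k \<omega> = 0"
      using assms(3)[OF k] by (force simp: posdef_def qform_def)
    then show "ctrl S v K k \<omega> = policyM S v K k (est S v K k \<omega>)"
      by (simp add: resid_def policyM_def algebra_simps)
  qed
qed

end
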